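(* Let $k\ge 1$ be an integer and let $\mathbb{K}$ be a finite field with $|\mathbb{K}|=q$ such that $\operatorname{char}(\mathbb{K})\nmid k$ and $\operatorname{char}(\mathbb{K})\nmid k+1$. Let $s$ be the number of elements $x\in\mathbb{K}$ with $x^{k+1}=x$. Consider the poset $X=\{x_0,x_1,\ldots,x_n,y_1,\ldots,y_m\}$ with the relations: - $x_0\le x_i$ for $i=1,\ldots,n$, and $x_i\le x_j$ for $1\le i\le j\le n$; - $x_0\le y_i$ for $i=1,\ldots,m$, and $y_i\le y_j$ for $1\le i\le j\le m$ (and no other relations besides reflexivity). Let $\mathcal{N}(X,k+1,\mathbb{K})$ be the number of $(k+1)$-potent elements of the incidence algebra $\mathcal{I}(X,\mathbb{K})$, and let $\mathcal{N}(n+1,k+1,\mathbb{K})$ be the number of $(k+1)$-potent elements in the algebra $UT_{n+1}(\mathbb{K})$ of upper triangular $(n+1)\times(n+1)$ matrices. Then $$\mathcal{N}(X,k+1,\mathbb{K})=\mathcal{N}(n+1,k+1,\mathbb{K})\cdot P(m,k+1),$$ where $$P(m,k+1)=\sum_{\substack{m_1+m_2+\cdots+m_s=m\\ m_i\ge 0}}\binom{m}{m_1,m_2,\ldots,m_s}\, q^{\sum_{1\le i<j\le s}m_im_j}\cdot q^{\sum_{i=2}^s m_i}.$$ In general, let $X=\bigcup_{i=1}^r X_i$ be a poset with minimal element $x_0$ such that each $X_i$ is a chain with $m_i+1$ elements whose least element is $x_0$, $X_i\cap X_j=\{x_0\}$ for $i\ne j$, and elements of $X_i\setminus\{x_0\}$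 and $X_j\setminus\{x_0\}$ are incomparable for $i\neq j$. Then the number of $(k+1)$-potent elements in $\mathcal{I}(X,\mathbb{K})$ is $$\mathcal{N}(X,k+1,\mathbb{K})=\mathcal{N}(X_1,k+1,\mathbb{K})\cdot\prod_{t=2}^r P(m_t,k+1).$$
   Context: For a finite poset $X$ and a field $\mathbb{K}$, the incidence algebra is $\mathcal{I}(X,\mathbb{K})=\{f:X\times X\to\mathbb{K}\ :\ f(x,y)=0 \text{ if } x\not\le y\}$ with pointwise addition and scalar multiplication and product $(f\cdot g)(x,y)=\sum_{x\le t\le y}f(x,t)g(t,y)$. An element $g$ is $(k+1)$-potent if $g^{k+1}=g$. For any finite poset $Z$, $\mathcal{N}(Z,k+1,\mathbb{K})$ denotes the number of $(k+1)$-potent elements of $\mathcal{I}(Z,\mathbb{K})$. $\binom{m}{m_1,\ldots,m_s}=\frac{m!}{m_1!\cdots m_s!}$ is the multinomial coefficient, and the sum defining $P(m,k+1)$ is over $s$-tuples of nonnegative integers with sum $m$. *)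

theory Defs
  imports
    "HOL-Algebra.Module"
    "HOL-Library.Cardinality"
    "HOL-Library.FuncSet"
    "HOL-Computational_Algebra.Field_as_Ring"
    "Jordan_Normal_Form.Matrix"
begin

text \<open>
  A finite poset is given by its carrier \<open>X\<close> and its order relation \<open>R \<subseteq> X \<times> X\<close>, where
  \<open>(x, y) \<in> R\<close> means \<open>x \<le> y\<close>. A function \<open>X \<times> X \<rightarrow> K\<close> is represented by its extension by zero
  to the whole type, so that distinct carrier elements are distinct functions on \<open>X \<times> X\<close>.
\<close>

definition incidence_algebra ::
  "'k itself \<Rightarrow> 'a set \<Rightarrow> 'a rel \<Rightarrow> ('k::field, 'a \<Rightarrow> 'a \<Rightarrow> 'k) module" where
  "incidence_algebra ty X R =
    \<lparr> carrier = {f. \<forall>x y. (x, y) \<notin> R \<longrightarrow> f x y = 0},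
      mult = (\<lambda>f g x y. \<Sum>t | (x, t) \<in> R \<and> (t, y) \<in> R. f x t * g t y),
      one = (\<lambda>x y. if x \<in> X \<and> x = y then 1 else 0),
      zero = (\<lambda>x y. 0),
      add = (\<lambda>f g x y. f x y + g x y),
      smult = (\<lambda>c f x y. c * f x y) \<rparr>"

definition UT :: "'k itself \<Rightarrow> nat \<Rightarrow> ('k::field) mat ring" where
  "UT ty n = (ring_mat ty n ())\<lparr>carrier := {A \<in> carrier_mat n n. upper_triangular A}\<rparr>"

definition num_potent :: "('a, 'b) monoid_scheme \<Rightarrow> nat \<Rightarrow> nat" where
  "num_potent A N = card {g \<in> carrier A. g [^]\<^bsub>A\<^esub> N = g}"

text \<open>The two-chain poset: \<open>x 0\<close> lies below the chain \<open>x 1, \<dots>, x n\<close> and the chain \<open>y 1, \<dots>, y m\<close>;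
  \<open>x 0, \<dots>, x n, y 1, \<dots>, y m\<close> are meant to be pairwise distinct.\<close>

definition fork_set :: "nat \<Rightarrow> nat \<Rightarrow> (nat \<Rightarrow> 'a) \<Rightarrow> (nat \<Rightarrow> 'a) \<Rightarrow> 'a set" where
  "fork_set n m x y = x ` {0..n} \<union> y ` {1..m}"

definition fork_rel :: "nat \<Rightarrow> nat \<Rightarrow> (nat \<Rightarrow> 'a) \<Rightarrow> (nat \<Rightarrow> 'a) \<Rightarrow> 'a rel" where
  "fork_rel n m x y =
     Id_on (fork_set n m x y)
     \<union> {(x 0, x i) | i. 1 \<le> i \<and> i \<le> n} \<union> {(x i, x j) | i j. 1 \<le> i \<and> i \<le> j \<and> j \<le> n}
     \<union> {(x 0, y i) | i. 1 \<le> i \<and> i \<le> m} \<union> {(y i, y j) | i j. 1 \<le> i \<and> i \<le> j \<and> j \<le> m}"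

text \<open>The division in \<open>multinomial\<close> is exact whenever \<open>\<mu> 1 + \<dots> + \<mu> s = m\<close>.\<close>

definition multinomial :: "nat \<Rightarrow> nat \<Rightarrow> (nat \<Rightarrow> nat) \<Rightarrow> nat" where
  "multinomial m s \<mu> = fact m div (\<Prod>i=1..s. fact (\<mu> i))"

text \<open>The number \<open>P(m, k+1)\<close>; it depends on \<open>k\<close> only through \<open>s\<close>, the number of
  \<open>(k+1)\<close>-potent scalars.\<close>

definition potent_factor :: "nat \<Rightarrow> nat \<Rightarrow> nat \<Rightarrow> nat" where
  "potent_factor q s m =
     (\<Sum>\<mu> | \<mu> \<in> {1..s} \<rightarrow>\<^sub>E UNIV \<and> (\<Sum>i=1..s. \<mu> i) = m.
        multinomial m s \<mu>
        * q ^ (\<Sum>(i, j) | 1 \<le> i \<and> i < j \<and> j \<le> s. \<mu> i * \<mu> j)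
        * q ^ (\<Sum>i=2..s. \<mu> i))"

end

theory Submission
  imports Defs "HOL-Combinatorics.Multiset_Permutations"
begin

text \<open>
  An entry \<open>f(x, y)\<close> of a potent element with prescribed diagonal \<open>d\<close> is chosen after all entries on
  smaller intervals. In the equation \<open>f\<^sup>k\<^sup>+\<^sup>1(x, y) = f(x, y)\<close> the unknown \<open>f(x, y)\<close> occurs linearly,
  with coefficient \<open>\<Sum>\<^sub>i d(x)\<^sup>i d(y)\<^sup>k\<^sup>-\<^sup>i - 1\<close>. If \<open>d(x) = d(y)\<close>, this is \<open>-1\<close> or \<open>k\<close>, hence nonzero, and the
  solution is unique. If \<open>d(x) \<noteq> d(y)\<close>, every value is a solution: \<open>h = f\<^sup>k\<^sup>+\<^sup>1 - f\<close> commutes with \<open>f\<close> and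
  vanishes on the smaller intervals, so \<open>(d(x) - d(y)) h(x, y) = 0\<close>. So in the incidence
  algebra of any finite poset there are \<open>q\<^sup>N\<close> potent elements with diagonal \<open>d\<close>, where \<open>N\<close> is the number of
  pairs \<open>x < y\<close> with \<open>d(x) \<noteq> d(y)\<close>. For chains glued at \<open>x\<^sub>0\<close> and a fixed value \<open>d(x\<^sub>0)\<close> the sum over \<open>d\<close>
  factors over the chains, and grouping the values on a chain by their multiplicities gives
  \<open>P(m, k+1)\<close> for each factor. The total is \<open>s\<close> times the product of these factors.
\<close>

subsection \<open>Potent elements of the incidence algebra of a finite poset\<close>

locale finite_poset =
  fixes ty :: "'k::field itself" and X :: "'a set" and R :: "'a rel"
  assumes finite_X: "finite X" and po: "partial_order_on X R"
begin

abbreviation A :: "('k, 'a \<Rightarrow> 'a \<Rightarrow> 'k) module" where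
  "A \<equiv> incidence_algebra ty X R"

lemma R_subset: "R \<subseteq> X \<times> X"
  and R_refl: "x \<in> X \<Longrightarrow> (x, x) \<in> R"
  and R_trans: "(x, y) \<in> R \<Longrightarrow> (y, z) \<in> R \<Longrightarrow> (x, z) \<in> R"
  and R_antisym: "(x, y) \<in> R \<Longrightarrow> (y, x) \<in> R \<Longrightarrow> x = y"
  using po unfolding partial_order_on_def preorder_on_def
  by (auto dest: refl_onD transD antisymD)

lemma R_in: "(x, y) \<in> R \<Longrightarrow> x \<in> X \<and> y \<in> X"
  using R_subset by auto

section \<open>The multiplicative monoid of incidence functions\<close>

lemma carrier_A: "f \<in> carrier A \<longleftrightarrow> (\<forall>x y. (x, y) \<notin> R \<longrightarrow> f x y = 0)"
  by (simp add: incidence_algebra_def)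

lemma one_A: "\<one>\<^bsub>A\<^esub> = (\<lambda>x y. if x \<in> X \<and> x = y then 1 else 0)"
  by (simp add: incidence_algebra_def)

text \<open>Outside the interval from \<open>x\<close> to \<open>y\<close> one of the two factors
  vanishes, so the sum may run over all of \<open>X\<close>. With this fixed index set,
  associativity is an exchange of two sums.\<close>

lemma mult_A:
  assumes "f \<in> carrier A" "g \<in> carrier A"
  shows "(f \<otimes>\<^bsub>A\<^esub> g) x y = (\<Sum>t\<in>X. f x t * g t y)"
proof -
  have "(f \<otimes>\<^bsub>A\<^esub> g) x y = (\<Sum>t | (x, t) \<in> R \<and> (t, y) \<in> R. f x t * g t y)"
    by (simp add: incidence_algebra_def)
  also have "\<dots> = (\<Sum>t\<in>X. f x t * g t y)"
    using assms finite_X R_subset by (intro sum.mono_neutral_left) (auto simp: carrier_A)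
  finally show ?thesis .
qed

text \<open>By transitivity there is no \<open>t\<close> between \<open>x\<close> and
  \<open>y\<close> unless \<open>(x, y)\<close> lies in \<open>R\<close>, so the defining sum is
  empty.\<close>

lemma mult_closed: "f \<otimes>\<^bsub>A\<^esub> g \<in> carrier A"
proof -
  have *: "{t. (x, t) \<in> R \<and> (t, y) \<in> R} = {}" if "(x, y) \<notin> R" for x y
    using that R_trans by blast
  show ?thesis
    by (simp add: incidence_algebra_def *)
qed

sublocale monoid A
proof
  show "f \<otimes>\<^bsub>A\<^esub> g \<in> carrier A" for f g by (rule mult_closed)
  show "\<one>\<^bsub>A\<^esub> \<in> carrier A" by (auto simp: carrier_A one_A R_refl)
next
  fix f g h assume fgh: "f \<in> carrier A" "g \<in> carrier A" "h \<in> carrier A"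
  show "f \<otimes>\<^bsub>A\<^esub> g \<otimes>\<^bsub>A\<^esub> h = f \<otimes>\<^bsub>A\<^esub> (g \<otimes>\<^bsub>A\<^esub> h)"
  proof (intro ext)
    fix x y
    have "(f \<otimes>\<^bsub>A\<^esub> g \<otimes>\<^bsub>A\<^esub> h) x y = (\<Sum>t\<in>X. \<Sum>u\<in>X. f x u * g u t * h t y)"
      using fgh by (simp add: mult_A mult_closed sum_distrib_right)
    also have "\<dots> = (\<Sum>u\<in>X. \<Sum>t\<in>X. f x u * g u t * h t y)"
      by (rule sum.swap)
    also have "\<dots> = (f \<otimes>\<^bsub>A\<^esub> (g \<otimes>\<^bsub>A\<^esub> h)) x y"
      using fgh by (simp add: mult_A mult_closed sum_distrib_left mult.assoc)
    finally show "(f \<otimes>\<^bsub>A\<^esub> g \<otimes>\<^bsub>A\<^esub> h) x y = (f \<otimes>\<^bsub>A\<^esub> (g \<otimes>\<^bsub>A\<^esub> h)) x y" .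
  qed
next
  have one: "\<one>\<^bsub>A\<^esub> \<in> carrier A" by (auto simp: carrier_A one_A R_refl)
  fix f assume f: "f \<in> carrier A"
  \<comment> \<open>The sums range over \<open>X\<close> only, so the unit laws have to be checked
    separately at indices outside \<open>X\<close>, where both sides are 0.\<close>
  have out: "f x y = 0" if "x \<notin> X \<or> y \<notin> X" for x y
    using f that R_subset by (auto simp: carrier_A)
  have *: "(if P then 1 else 0) * a = (if P then a else 0)"
    "a * (if P then 1 else 0) = (if P then a else 0)" for P and a :: 'k by auto
  have l: "(\<one>\<^bsub>A\<^esub> \<otimes>\<^bsub>A\<^esub> f) x y = f x y" for x y
    unfolding mult_A[OF one f] using finite_X out
    by (cases "x \<in> X") (auto simp: one_A * sum.delta cong: if_cong)
  have r: "(f \<otimes>\<^bsub>A\<^esub> \<one>\<^bsub>A\<^esub>) x y = f x y" for x y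
    unfolding mult_A[OF f one] using finite_X out
    by (cases "y \<in> X") (auto simp: one_A * sum.delta sum.delta' cong: if_cong conj_cong)
  show "\<one>\<^bsub>A\<^esub> \<otimes>\<^bsub>A\<^esub> f = f" "f \<otimes>\<^bsub>A\<^esub> \<one>\<^bsub>A\<^esub> = f"
    using l r by (auto intro!: ext)
qed

section \<open>Entries of powers and their dependence on a single entry\<close>

lemma pow_diag:
  assumes f: "f \<in> carrier A" and x: "x \<in> X"
  shows "(f [^]\<^bsub>A\<^esub> (n::nat)) x x = f x x ^ n"
proof (induction n)
  case 0
  then show ?case using x by (simp add: one_A)
next
  case (Suc n)
  have pn: "f [^]\<^bsub>A\<^esub> n \<in> carrier A" using f by simp
  have "(f [^]\<^bsub>A\<^esub> Suc n) x x = (\<Sum>t\<in>X. (f [^]\<^bsub>A\<^esub> n) x t * f t x)"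
    using f by (simp add: mult_A)
  \<comment> \<open>By antisymmetry the interval from \<open>x\<close> to \<open>x\<close> is
    \<open>{x}\<close>, so diagonal entries simply multiply.\<close>
  also have "\<dots> = (\<Sum>t\<in>{x}. (f [^]\<^bsub>A\<^esub> n) x t * f t x)"
  proof (intro sum.mono_neutral_right ballI)
    fix t assume "t \<in> X - {x}"
    then have "(x, t) \<notin> R \<or> (t, x) \<notin> R" using R_antisym by blast
    then show "(f [^]\<^bsub>A\<^esub> n) x t * f t x = 0" using f pn by (auto simp: carrier_A)
  qed (use finite_X x in auto)
  finally show ?case using Suc by (simp add: mult.commute)
qed

text \<open>An entry of a power at \<open>(u, v)\<close> is a sum over multichains from
  \<open>u\<close> to \<open>v\<close>, and these stay inside that interval. This locality allows
  entries to be chosen one after the other.\<close>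

lemma pow_cong_interval:
  assumes f: "f \<in> carrier A" and g: "g \<in> carrier A"
    and eq: "\<And>s t. (u, s) \<in> R \<Longrightarrow> (s, t) \<in> R \<Longrightarrow> (t, v) \<in> R \<Longrightarrow> f s t = g s t"
  shows "(f [^]\<^bsub>A\<^esub> (n::nat)) u v = (g [^]\<^bsub>A\<^esub> n) u v"
  using eq
\<comment> \<open>Only \<open>v\<close> varies: the last factor leads from \<open>t\<close> to
  \<open>v\<close>, and the remaining power lives on the interval from \<open>u\<close> to
  \<open>t\<close>.\<close>
proof (induction n arbitrary: v)
  case 0
  then show ?case by simp
next
  case (Suc n)
  have pn: "f [^]\<^bsub>A\<^esub> n \<in> carrier A" "g [^]\<^bsub>A\<^esub> n \<in> carrier A" using f g by simp_all
  have "(f [^]\<^bsub>A\<^esub> n) u t * f t v = (g [^]\<^bsub>A\<^esub> n) u t * g t v" if "t \<in> X" for t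
  proof (cases "(u, t) \<in> R \<and> (t, v) \<in> R")
    case True
    have "(f [^]\<^bsub>A\<^esub> n) u t = (g [^]\<^bsub>A\<^esub> n) u t"
      using True R_trans by (intro Suc.IH Suc.prems) blast+
    moreover have "f t v = g t v"
      using True R_in R_refl by (intro Suc.prems) blast+
    ultimately show ?thesis by simp
  next
    case False
    then show ?thesis using f g pn by (auto simp: carrier_A)
  qed
  then show ?case using f g by (simp add: mult_A)
qed

text \<open>A multichain of \<open>n\<close> steps from \<open>x\<close> to \<open>y\<close> uses
  the pair \<open>(x, y)\<close> at most once, after \<open>i\<close> steps resting at
  \<open>x\<close> and before \<open>n - Suc i\<close> steps resting at \<open>y\<close>. So the
  entry of the power is affine in the entry \<open>f x y\<close>, with the stated sum as
  slope.\<close>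

lemma pow_upd:
  assumes f: "f \<in> carrier A" and xy: "(x, y) \<in> R" "x \<noteq> y"
    and g: "g = f(x := (f x)(y := c))"
  shows "(g [^]\<^bsub>A\<^esub> (n::nat)) x y
    = (f [^]\<^bsub>A\<^esub> n) x y + (c - f x y) * (\<Sum>i<n. f x x ^ i * f y y ^ (n - Suc i))"
proof (induction n)
  case 0
  then show ?case by simp
next
  case (Suc n)
  have gc: "g \<in> carrier A" using f xy by (auto simp: g carrier_A)
  have X: "x \<in> X" "y \<in> X" using xy R_in by auto
  have geq: "g u v = f u v" if "u \<noteq> x \<or> v \<noteq> y" for u v using that by (auto simp: g)
  have pn: "f [^]\<^bsub>A\<^esub> n \<in> carrier A" "g [^]\<^bsub>A\<^esub> n \<in> carrier A" using f gc by simp_all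
  \<comment> \<open>For \<open>t\<close> other than the endpoints, the interval from
    \<open>x\<close> to \<open>t\<close> does not contain \<open>y\<close>, hence these terms do not
    see the changed entry.\<close>
  have mid: "(g [^]\<^bsub>A\<^esub> n) x t * g t y = (f [^]\<^bsub>A\<^esub> n) x t * f t y" if t: "t \<in> X - {x} - {y}" for t
  proof (cases "(x, t) \<in> R \<and> (t, y) \<in> R")
    case True
    have "(g [^]\<^bsub>A\<^esub> n) x t = (f [^]\<^bsub>A\<^esub> n) x t"
    proof (rule pow_cong_interval[OF gc f])
      fix a b assume "(b, t) \<in> R"
      then show "g a b = f a b" using True t R_antisym by (intro geq) blast
    qed
    moreover have "g t y = f t y" using t by (intro geq) auto
    ultimately show ?thesis by simp
  next
    case False
    then show ?thesis using f gc pn by (auto simp: carrier_A)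
  qed
  \<comment> \<open>The changed entry enters only through \<open>t = x\<close> as last factor and
    through \<open>t = y\<close> inside the smaller power.\<close>
  have split: "(h [^]\<^bsub>A\<^esub> Suc n) x y = h x x ^ n * h x y + (h [^]\<^bsub>A\<^esub> n) x y * h y y
      + (\<Sum>t\<in>X - {x} - {y}. (h [^]\<^bsub>A\<^esub> n) x t * h t y)" if h: "h \<in> carrier A" for h
  proof -
    have "(h [^]\<^bsub>A\<^esub> Suc n) x y = (\<Sum>t\<in>X. (h [^]\<^bsub>A\<^esub> n) x t * h t y)"
      using h by (simp add: mult_A)
    also have "\<dots> = (h [^]\<^bsub>A\<^esub> n) x x * h x y + ((h [^]\<^bsub>A\<^esub> n) x y * h y y
      + (\<Sum>t\<in>X - {x} - {y}. (h [^]\<^bsub>A\<^esub> n) x t * h t y))"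
      using X xy finite_X by (simp add: sum.remove[of X x] sum.remove[of "X - {x}" y])
    finally show ?thesis using pow_diag[OF h X(1)] by (simp add: add.assoc)
  qed
  \<comment> \<open>The slope satisfies the matching recursion: either the jump was made earlier and
    one more step rests at \<open>y\<close>, or the jump is the last step.\<close>
  have S: "(\<Sum>i<Suc n. f x x ^ i * f y y ^ (Suc n - Suc i))
    = (\<Sum>i<n. f x x ^ i * f y y ^ (n - Suc i)) * f y y + f x x ^ n"
  proof -
    have "f x x ^ i * f y y ^ (Suc n - Suc i) = f x x ^ i * f y y ^ (n - Suc i) * f y y"
      if "i < n" for i
    proof -
      have "Suc n - Suc i = Suc (n - Suc i)" using that by simp
      then show ?thesis by simp
    qed
    then have "(\<Sum>i<n. f x x ^ i * f y y ^ (Suc n - Suc i))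
      = (\<Sum>i<n. f x x ^ i * f y y ^ (n - Suc i) * f y y)"
      by (intro sum.cong) auto
    then show ?thesis by (simp add: sum_distrib_right)
  qed
  have d: "g x x = f x x" "g y y = f y y" "g x y = c" using xy by (auto simp: g)
  show ?case
    unfolding split[OF gc] split[OF f] S d Suc
    using mid by (simp add: algebra_simps)
qed

text \<open>The power commutes with \<open>f\<close>. Comparing the entries of both products at
  \<open>(x, y)\<close>, all terms other than those with the power's own \<open>(x, y)\<close> entry
  are known from \<open>below\<close>, which includes the diagonal pairs \<open>u = v\<close>. What
  remains is the discrepancy at \<open>(x, y)\<close> times \<open>f x x - f y y\<close>.\<close>

lemma pow_free_entry:
  assumes f: "f \<in> carrier A" and xy: "(x, y) \<in> R" and ne: "f x x \<noteq> f y y"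
    and below: "\<And>u v. (x, u) \<in> R \<Longrightarrow> (u, v) \<in> R \<Longrightarrow> (v, y) \<in> R \<Longrightarrow> (u, v) \<noteq> (x, y)
      \<Longrightarrow> (f [^]\<^bsub>A\<^esub> n) u v = f u v"
  shows "(f [^]\<^bsub>A\<^esub> (n::nat)) x y = f x y"
proof -
  define F where "F = f [^]\<^bsub>A\<^esub> n"
  have F: "F \<in> carrier A" using f by (simp add: F_def)
  have X: "x \<in> X" "y \<in> X" using xy R_in by auto
  have comm: "F \<otimes>\<^bsub>A\<^esub> f = f \<otimes>\<^bsub>A\<^esub> F" unfolding F_def using f nat_pow_Suc2[OF f, of n] by simp
  have "(F \<otimes>\<^bsub>A\<^esub> f) x y = F x y * f y y + (\<Sum>t\<in>X - {y}. f x t * f t y)"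
  proof -
    have "F x t * f t y = f x t * f t y" if "t \<in> X - {y}" for t
    proof (cases "(x, t) \<in> R \<and> (t, y) \<in> R")
      case True
      then have "F x t = f x t" unfolding F_def using that X R_refl by (intro below) auto
      then show ?thesis by simp
    next
      case False
      then show ?thesis using f F by (auto simp: carrier_A)
    qed
    then have "(\<Sum>t\<in>X - {y}. F x t * f t y) = (\<Sum>t\<in>X - {y}. f x t * f t y)"
      by (intro sum.cong) auto
    then show ?thesis using X finite_X by (simp add: mult_A[OF F f] sum.remove[of X y])
  qed
  moreover have "(f \<otimes>\<^bsub>A\<^esub> F) x y = f x x * F x y + (\<Sum>t\<in>X - {x}. f x t * f t y)"
  proof -
    have "f x t * F t y = f x t * f t y" if "t \<in> X - {x}" for t
    proof (cases "(x, t) \<in> R \<and> (t, y) \<in> R")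
      case True
      then have "F t y = f t y" unfolding F_def using that X R_refl by (intro below) auto
      then show ?thesis by simp
    next
      case False
      then show ?thesis using f F by (auto simp: carrier_A)
    qed
    then have "(\<Sum>t\<in>X - {x}. f x t * F t y) = (\<Sum>t\<in>X - {x}. f x t * f t y)"
      by (intro sum.cong) auto
    then show ?thesis using X finite_X by (simp add: mult_A[OF f F] sum.remove[of X x])
  qed
  \<comment> \<open>Both sides are the full sum for the entry of \<open>f\<close> squared at
    \<open>(x, y)\<close>, once with \<open>t = y\<close> and once with \<open>t = x\<close> split
    off. This relates the two partial sums.\<close>
  moreover have "(\<Sum>t\<in>X - {y}. f x t * f t y) + f x y * f y y
      = (\<Sum>t\<in>X - {x}. f x t * f t y) + f x x * f x y"
    using X finite_X
      sum.remove[of X x "\<lambda>t. f x t * f t y"] sum.remove[of X y "\<lambda>t. f x t * f t y"]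
    by (simp add: add.commute)
  ultimately have
    1: "F x y * f y y + (\<Sum>t\<in>X - {y}. f x t * f t y)
      = f x x * F x y + (\<Sum>t\<in>X - {x}. f x t * f t y)" and
    2: "(\<Sum>t\<in>X - {y}. f x t * f t y) + f x y * f y y
      = (\<Sum>t\<in>X - {x}. f x t * f t y) + f x x * f x y"
    using comm by simp_all
  \<comment> \<open>The two partial sums are generalised to \<open>p\<close> and \<open>q\<close>,
    so that only their difference is left to eliminate.\<close>
  have "F x y * f y y - f x x * F x y = f x y * f y y - f x x * f x y"
    if "F x y * f y y + p = f x x * F x y + q" "p + f x y * f y y = q + f x x * f x y" for p q
  proof -
    have "F x y * f y y - f x x * F x y = q - p" "f x y * f y y - f x x * f x y = q - p"
      using that by (simp_all add: algebra_simps)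
    then show ?thesis by simp
  qed
  from this[OF 1 2] have "(F x y - f x y) * (f x x - f y y) = 0"
    by (simp add: algebra_simps)
  then show ?thesis using ne by (simp add: F_def)
qed

section \<open>Counting potent elements with a prescribed diagonal\<close>

declare nat_pow_Suc [simp del] Group.nat_pow_Suc [simp del]

text \<open>Such a set \<open>T\<close> holds the strict pairs whose entries have already been
  chosen. Closure under smaller intervals ensures that the power at a pair of \<open>T\<close>
  involves only the diagonal and entries at pairs of \<open>T\<close>.\<close>

definition interval_closed :: "'a rel \<Rightarrow> bool" where
  "interval_closed T \<longleftrightarrow> T \<subseteq> R - Id \<and>
    (\<forall>x y u v. (x, y) \<in> T \<and> (x, u) \<in> R \<and> (u, v) \<in> R \<and> (v, y) \<in> R \<and> u \<noteq> v \<longrightarrow> (u, v) \<in> T)"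

lemma interval_closedD:
  assumes "interval_closed T" "(x, y) \<in> T" "(x, u) \<in> R" "(u, v) \<in> R" "(v, y) \<in> R" "u \<noteq> v"
  shows "(u, v) \<in> T"
  using assms unfolding interval_closed_def by metis

text \<open>These are the partial solutions: potency is demanded on \<open>T\<close> only, and the
  strict entries not yet chosen are pinned to 0 so that each partial solution is counted once. The
  diagonal is prescribed by \<open>d\<close>; its potency is a property of \<open>d\<close>.\<close>

definition potents_on :: "nat \<Rightarrow> ('a \<Rightarrow> 'k) \<Rightarrow> 'a rel \<Rightarrow> ('a \<Rightarrow> 'a \<Rightarrow> 'k) set" where
  "potents_on n d T = {f \<in> carrier A. (\<forall>x\<in>X. f x x = d x) \<and>
    (\<forall>u v. (u, v) \<in> R - Id - T \<longrightarrow> f u v = 0) \<and> (\<forall>u v. (u, v) \<in> T \<longrightarrow> (f [^]\<^bsub>A\<^esub> n) u v = f u v)}"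

text \<open>A pair of \<open>T\<close> whose interval has the largest cardinality lies in the
  interval of no other pair of \<open>T\<close>, so closure survives its removal.\<close>

lemma interval_closed_remove:
  assumes T: "interval_closed T" "T \<noteq> {}"
  obtains x y where "(x, y) \<in> T" "interval_closed (T - {(x, y)})"
proof -
  define I where "I p = {t. (fst p, t) \<in> R \<and> (t, snd p) \<in> R}" for p
  have "finite R" using R_subset finite_X by (meson finite_SigmaI finite_subset)
  then have fT: "finite T" using T(1) unfolding interval_closed_def by (meson finite_Diff finite_subset)
  have fI: "finite (I p)" for p
    unfolding I_def using R_subset finite_X by (auto intro: finite_subset[of _ X])
  have "Max ((\<lambda>p. card (I p)) ` T) \<in> (\<lambda>p. card (I p)) ` T"
    using fT T(2) by (intro Max_in) auto
  then obtain p where "p \<in> T" "card (I p) = Max ((\<lambda>p. card (I p)) ` T)" by auto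
  then have p: "p \<in> T" "\<forall>p'\<in>T. card (I p') \<le> card (I p)"
    using fT by auto
  obtain x y where xy: "p = (x, y)" by (cases p)
  have "interval_closed (T - {(x, y)})"
    unfolding interval_closed_def
  proof (intro conjI allI impI)
    show "T - {(x, y)} \<subseteq> R - Id" using T by (auto simp: interval_closed_def)
    fix a b u v assume *: "(a, b) \<in> T - {(x, y)} \<and> (a, u) \<in> R \<and> (u, v) \<in> R \<and> (v, b) \<in> R \<and> u \<noteq> v"
    then have "(u, v) \<in> T" using interval_closedD[OF T(1), of a b u v] by simp
    moreover have "(u, v) \<noteq> (x, y)"
    proof
      assume "(u, v) = (x, y)"
      with * have ax: "(a, x) \<in> R" and xy': "(x, y) \<in> R" and yb: "(y, b) \<in> R"
        and ne: "(a, b) \<noteq> (x, y)" by auto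
      have "I (x, y) \<subseteq> I (a, b)"
        using R_trans[OF ax] R_trans[OF _ yb] unfolding I_def by auto
      \<comment> \<open>If both \<open>a\<close> and \<open>b\<close> lay between \<open>x\<close>
        and \<open>y\<close>, antisymmetry would force \<open>a = x\<close> and
        \<open>b = y\<close>. Hence the inclusion of intervals is strict, against
        maximality.\<close>
      moreover have "a \<notin> I (x, y) \<or> b \<notin> I (x, y)"
        using ne R_antisym[OF ax] R_antisym[OF yb] unfolding I_def by auto
      moreover have "a \<in> I (a, b)" "b \<in> I (a, b)"
        using R_refl R_in[OF ax] R_in[OF yb] R_trans[OF R_trans[OF ax xy'] yb] unfolding I_def by auto
      ultimately have "I (x, y) \<subset> I (a, b)" by blast
      then have "card (I (x, y)) < card (I (a, b))" by (rule psubset_card_mono[OF fI])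
      then show False using p(2)[rule_format, of "(a, b)"] xy * by simp
    qed
    ultimately show "(u, v) \<in> T - {(x, y)}" by simp
  qed
  then show thesis using that p xy by blast
qed

text \<open>Induction on the size of \<open>T\<close>: after removal of a maximal pair
  \<open>(x, y)\<close>, each partial solution on the rest extends by any scalar if
  \<open>d x\<close> and \<open>d y\<close> differ, and by exactly one scalar otherwise. Finiteness
  is carried along because the step sums over the smaller solution set.\<close>

lemma card_potents_on:
  assumes K: "finite (UNIV :: 'k set)" and k: "k \<ge> 1" "of_nat k \<noteq> (0 :: 'k)"
    and d: "\<And>x. x \<in> X \<Longrightarrow> d x ^ Suc k = d x"
    and T: "interval_closed T"
  shows "finite (potents_on (Suc k) d T) \<and>
    card (potents_on (Suc k) d T) = CARD('k) ^ card {(x, y) \<in> T. d x \<noteq> d y}"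
  using T
proof (induction "card T" arbitrary: T rule: less_induct)
  case less
  have "finite R" using R_subset finite_X by (meson finite_SigmaI finite_subset)
  then have fT: "finite T" using less.prems unfolding interval_closed_def
    by (meson finite_Diff finite_subset)
  show ?case
  proof (cases "T = {}")
    case True
    have "potents_on (Suc k) d T = {\<lambda>u v. if u \<in> X \<and> u = v then d u else 0}" (is "_ = {?g}")
    proof (intro equalityI subsetI)
      fix f assume "f \<in> potents_on (Suc k) d T"
      then have "f u v = ?g u v" for u v
        using True R_in unfolding potents_on_def carrier_A by (cases "(u, v) \<in> R") auto
      then have "f = ?g" by blast
      then show "f \<in> {?g}" by simp
    next
      fix f assume "f \<in> {?g}"
      then show "f \<in> potents_on (Suc k) d T"
        using True R_refl unfolding potents_on_def carrier_A by auto
    qed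
    then show ?thesis using True by simp
  next
    case False
    obtain x y where xy: "(x, y) \<in> T" and T': "interval_closed (T - {(x, y)})"
      using interval_closed_remove[OF less.prems False] by blast
    define T' where "T' = T - {(x, y)}"
    have xyR: "(x, y) \<in> R" "x \<noteq> y" using xy less.prems by (auto simp: interval_closed_def)
    have X: "x \<in> X" "y \<in> X" using xyR R_in by auto
    define upd where "upd g c = g(x := (g x)(y := c))" for g :: "'a \<Rightarrow> 'a \<Rightarrow> 'k" and c
    have upd: "upd g c u v = (if u = x \<and> v = y then c else g u v)" for g c u v
      by (auto simp: upd_def)
    have T'I: "(s, t) \<in> T'" if "(u, v) \<in> T'" "(u, s) \<in> R" "(s, t) \<in> R" "(t, v) \<in> R" "s \<noteq> t" for u v s t
      using interval_closedD[OF T'] that unfolding T'_def by blast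
    have xyT': "(x, y) \<notin> T'" by (simp add: T'_def)
    have carr: "upd g c \<in> carrier A" if "g \<in> carrier A" for g c
      using that xyR by (auto simp: carrier_A upd)
    \<comment> \<open>No interval of a pair in \<open>T'\<close> contains \<open>(x, y)\<close>,
      since \<open>T'\<close> is closed and lacks this pair. So the choice made at
      \<open>(x, y)\<close> cannot disturb potency on \<open>T'\<close>.\<close>
    have pow_T': "(upd g c [^]\<^bsub>A\<^esub> (n::nat)) u v = (g [^]\<^bsub>A\<^esub> n) u v"
      if "g \<in> carrier A" "(u, v) \<in> T'" for g c n u v
    proof (rule pow_cong_interval)
      fix s t assume "(u, s) \<in> R" "(s, t) \<in> R" "(t, v) \<in> R"
      then have "(s, t) \<noteq> (x, y)" using T'I[OF that(2)] xyT' xyR by blast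
      then show "upd g c s t = g s t" by (auto simp: upd)
    qed (use that carr in auto)
    \<comment> \<open>\<open>D\<close> is the slope from \<open>pow_upd\<close> for the exponent
      \<open>Suc k\<close>. Since members of \<open>V\<close> vanish at \<open>(x, y)\<close>,
      placing \<open>c\<close> there turns potency at this pair into the affine equation that
      defines \<open>C g\<close>.\<close>
    define D where "D = (\<Sum>i<Suc k. d x ^ i * d y ^ (Suc k - Suc i))"
    define V where "V = potents_on (Suc k) d T'"
    define C where "C g = {c. (g [^]\<^bsub>A\<^esub> Suc k) x y + c * D = c}" for g
    have V: "g \<in> carrier A" "\<And>z. z \<in> X \<Longrightarrow> g z z = d z" "g x y = 0"
      "\<And>u v. (u, v) \<in> R - Id - T' \<Longrightarrow> g u v = 0"
      "\<And>u v. (u, v) \<in> T' \<Longrightarrow> (g [^]\<^bsub>A\<^esub> Suc k) u v = g u v" if "g \<in> V" for g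
      using that xyR xyT' unfolding V_def potents_on_def by auto
    have pow_xy: "(upd g c [^]\<^bsub>A\<^esub> Suc k) x y = (g [^]\<^bsub>A\<^esub> Suc k) x y + (c - g x y) * D"
      if "g \<in> carrier A" "\<And>z. z \<in> X \<Longrightarrow> g z z = d z" for g c
      using pow_upd[OF that(1) xyR upd_def, of c "Suc k"] that X unfolding D_def by simp
    \<comment> \<open>A solution on \<open>T\<close> is a solution on \<open>T'\<close> together
      with an admissible value at \<open>(x, y)\<close>; conversely, resetting this value to 0
      recovers the solution on \<open>T'\<close>.\<close>
    have eq: "potents_on (Suc k) d T = (\<lambda>(g, c). upd g c) ` Sigma V C"
    proof (intro equalityI subsetI)
      fix f assume "f \<in> (\<lambda>(g, c). upd g c) ` Sigma V C"
      then obtain g c where g: "g \<in> V" and c: "c \<in> C g" and f: "f = upd g c" by auto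
      show "f \<in> potents_on (Suc k) d T"
        unfolding potents_on_def
      proof (intro CollectI conjI ballI allI impI)
        show "f \<in> carrier A" using g f V carr by auto
        show "f z z = d z" if "z \<in> X" for z using that f V(2)[OF g] xyR by (auto simp: upd)
        show "f u v = 0" if "(u, v) \<in> R - Id - T" for u v
          using that f V(4)[OF g, of u v] xy by (auto simp: upd T'_def)
        show "(f [^]\<^bsub>A\<^esub> Suc k) u v = f u v" if "(u, v) \<in> T" for u v
        proof (cases "(u, v) = (x, y)")
          case True
          then show ?thesis using c pow_xy[of g c] V[OF g] f by (simp add: C_def upd)
        next
          case False
          then have "(u, v) \<in> T'" using that by (auto simp: T'_def)
          then show ?thesis using pow_T'[of g u v c] V(1,5)[OF g] f False
            by (auto simp: upd)
        qed
      qed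
    next
      fix f assume f: "f \<in> potents_on (Suc k) d T"
      then have f': "f \<in> carrier A" "\<And>z. z \<in> X \<Longrightarrow> f z z = d z"
        "\<And>u v. (u, v) \<in> R - Id - T \<Longrightarrow> f u v = 0"
        "\<And>u v. (u, v) \<in> T \<Longrightarrow> (f [^]\<^bsub>A\<^esub> Suc k) u v = f u v"
        unfolding potents_on_def by blast+
      define g where "g = upd f 0"
      have fg: "f = upd g (f x y)" by (intro ext) (auto simp: upd g_def)
      have gc: "g \<in> carrier A" using carr f' by (simp add: g_def)
      have gz: "g z z = d z" if "z \<in> X" for z using f'(2)[OF that] xyR by (auto simp: g_def upd)
      have gxy: "g x y = 0" by (simp add: g_def upd)
      have "g \<in> V" unfolding V_def potents_on_def
      proof (intro CollectI conjI ballI allI impI)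
        show "g u v = 0" if "(u, v) \<in> R - Id - T'" for u v
          using that f'(3)[of u v] by (auto simp: g_def upd T'_def)
        show "(g [^]\<^bsub>A\<^esub> Suc k) u v = g u v" if "(u, v) \<in> T'" for u v
          using pow_T'[OF f'(1) that, of 0 "Suc k"] f'(4)[of u v] that
          by (auto simp: g_def upd T'_def)
      qed (use gc gz in auto)
      moreover have "f x y \<in> C g"
        using pow_xy[OF gc gz, of "f x y"] f'(4)[OF xy]
        by (simp add: fg[symmetric] C_def gxy)
      ultimately have "(g, f x y) \<in> Sigma V C" by blast
      then have "(\<lambda>(g, c). upd g c) (g, f x y) \<in> (\<lambda>(g, c). upd g c) ` Sigma V C"
        by (rule imageI)
      then show "f \<in> (\<lambda>(g, c). upd g c) ` Sigma V C"
        by (simp only: prod.case fg[symmetric])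
    qed
    have inj: "inj_on (\<lambda>(g, c). upd g c) (Sigma V C)"
    proof (rule inj_onI, clarify)
      fix g c g' c' assume g: "g \<in> V" "g' \<in> V" and e: "upd g c = upd g' c'"
      have "upd g c u v = upd g' c' u v" for u v using e by simp
      then have *: "(if u = x \<and> v = y then c else g u v) = (if u = x \<and> v = y then c' else g' u v)" for u v
        by (simp add: upd)
      have "g u v = g' u v" for u v using *[of u v] V(3)[OF g(1)] V(3)[OF g(2)] by (auto split: if_splits)
      then show "g = g' \<and> c = c'" using *[of x y] by auto
    qed
    have cardC: "card (C g) = (if d x \<noteq> d y then CARD('k) else 1)" if g: "g \<in> V" for g
    proof (cases "d x = d y")
      case False
      \<comment> \<open>Every smaller pair is either diagonal, where \<open>d\<close> is potent, or
        in \<open>T'\<close>, where \<open>g\<close> already solves the equation. So the commutation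
        argument leaves \<open>c\<close> free.\<close>
      have "(upd g c [^]\<^bsub>A\<^esub> Suc k) x y = upd g c x y" for c
      proof (rule pow_free_entry)
        show "upd g c \<in> carrier A" using carr V[OF g] by auto
        show "upd g c x x \<noteq> upd g c y y" using False V[OF g] X xyR by (auto simp: upd)
        fix u v assume uv: "(x, u) \<in> R" "(u, v) \<in> R" "(v, y) \<in> R" "(u, v) \<noteq> (x, y)"
        show "(upd g c [^]\<^bsub>A\<^esub> Suc k) u v = upd g c u v"
        proof (cases "u = v")
          case True
          then show ?thesis using uv xyR R_in pow_diag[of "upd g c" v "Suc k"] d V[OF g] carr[of g c]
            by (auto simp: upd simp del: power_Suc)
        next
          case False
          then have "(u, v) \<in> T'"
            using uv interval_closedD[OF less.prems xy] unfolding T'_def by blast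
          then show ?thesis using uv pow_T'[of g u v c "Suc k"] V(1)[OF g] V(5)[OF g, of u v]
            by (auto simp: upd)
        qed
      qed (use xyR in auto)
      then have "C g = UNIV" using pow_xy[of g] V[OF g] unfolding C_def by (auto simp: upd)
      then show ?thesis using False by simp
    next
      case True
      have "D = of_nat (Suc k) * d x ^ k"
      proof -
        have "D = (\<Sum>i<Suc k. d x ^ k)" unfolding D_def
        proof (rule sum.cong[OF refl])
          fix i assume "i \<in> {..<Suc k}"
          then have "i + (Suc k - Suc i) = k" by simp
          then show "d x ^ i * d y ^ (Suc k - Suc i) = d x ^ k"
            using True by (metis power_add)
        qed
        then show ?thesis by simp
      qed
      \<comment> \<open>If \<open>d x = 0\<close>, then \<open>k \<ge> 1\<close> gives
        \<open>D = 0\<close>; otherwise \<open>D = k + 1\<close>. So \<open>D - 1\<close> is -1 or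
        \<open>k\<close>, and the affine equation has one root.\<close>
      moreover have "d x = 0 \<or> d x ^ k = 1" using d[OF X(1)] by auto
      ultimately have ne: "D - 1 \<noteq> 0" using k by (auto simp: power_0_left)
      have "C g = {- (g [^]\<^bsub>A\<^esub> Suc k) x y / (D - 1)}"
        using ne unfolding C_def
        by (auto simp: field_simps)
      then show ?thesis using True by simp
    qed
    have fC: "finite (C g)" for g using K by (rule finite_subset[rotated]) simp
    have IH: "finite V" "card V = CARD('k) ^ card {(x, y) \<in> T'. d x \<noteq> d y}"
      using less.hyps[of T'] T' card_Diff1_less[OF fT xy] unfolding V_def T'_def by blast+
    have "card (potents_on (Suc k) d T) = (\<Sum>g\<in>V. card (C g))"
      unfolding eq using card_image[OF inj] IH fC by (simp add: card_SigmaI)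
    also have "\<dots> = (if d x \<noteq> d y then CARD('k) else 1) * card V"
      using cardC by simp
    also have "\<dots> = CARD('k) ^ card {(x, y) \<in> T. d x \<noteq> d y}"
    proof (cases "d x = d y")
      case True
      then have "{(x, y) \<in> T. d x \<noteq> d y} = {(x, y) \<in> T'. d x \<noteq> d y}" by (auto simp: T'_def)
      then show ?thesis using IH True by simp
    next
      case False
      then have "{(x, y) \<in> T. d x \<noteq> d y} = insert (x, y) {(x, y) \<in> T'. d x \<noteq> d y}"
        using xy by (auto simp: T'_def)
      moreover have "finite {(x, y) \<in> T'. d x \<noteq> d y}"
        by (rule finite_subset[OF _ fT]) (auto simp: T'_def)
      ultimately show ?thesis using IH False xyT' by simp
    qed
    finally show ?thesis using IH fC unfolding eq by simp
  qed
qed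

text \<open>Potent elements are partitioned by their diagonals, whose values are potent scalars by
  \<open>pow_diag\<close>. The set \<open>R - Id\<close> is interval-closed, and for it the partial
  solutions are the full ones. Extensionality of \<open>d\<close> gives each potent element exactly
  one index.\<close>

theorem num_potent_eq_sum:
  assumes K: "finite (UNIV :: 'k set)" and k: "k \<ge> 1" "of_nat k \<noteq> (0 :: 'k)"
  shows "num_potent A (Suc k) =
    (\<Sum>d\<in>X \<rightarrow>\<^sub>E {a :: 'k. a ^ Suc k = a}. CARD('k) ^ card {(x, y) \<in> R. d x \<noteq> d y})"
proof -
  define S where "S = {a :: 'k. a ^ Suc k = a}"
  have fS: "finite S" using K by (rule finite_subset[rotated]) simp
  have closed: "interval_closed (R - Id)" unfolding interval_closed_def by blast
  have potents: "d x ^ Suc k = d x" if "d \<in> X \<rightarrow>\<^sub>E S" "x \<in> X" for d x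
    using PiE_mem[OF that] by (simp only: S_def mem_Collect_eq)
  have card_d: "finite (potents_on (Suc k) d (R - Id)) \<and>
      card (potents_on (Suc k) d (R - Id)) = CARD('k) ^ card {(x, y) \<in> R - Id. d x \<noteq> d y}"
    if "d \<in> X \<rightarrow>\<^sub>E S" for d
    by (rule card_potents_on[OF K k _ closed]) (rule potents[OF that])
  have eq: "{g \<in> carrier A. g [^]\<^bsub>A\<^esub> Suc k = g} = (\<Union>d\<in>X \<rightarrow>\<^sub>E S. potents_on (Suc k) d (R - Id))"
  proof (intro equalityI subsetI)
    fix g assume g: "g \<in> {g \<in> carrier A. g [^]\<^bsub>A\<^esub> Suc k = g}"
    let ?d = "\<lambda>x\<in>X. g x x"
    have "g \<in> potents_on (Suc k) ?d (R - Id)"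
      using g unfolding potents_on_def by (auto)
    moreover have "?d \<in> X \<rightarrow>\<^sub>E S"
    proof -
      have "g x x ^ Suc k = g x x" if "x \<in> X" for x
        using g pow_diag[of g x "Suc k"] that by (auto simp del: power_Suc)
      then show ?thesis unfolding S_def by (auto simp del: power_Suc)
    qed
    ultimately show "g \<in> (\<Union>d\<in>X \<rightarrow>\<^sub>E S. potents_on (Suc k) d (R - Id))" by blast
  next
    fix g assume "g \<in> (\<Union>d\<in>X \<rightarrow>\<^sub>E S. potents_on (Suc k) d (R - Id))"
    then obtain d where d: "d \<in> X \<rightarrow>\<^sub>E S" and g: "g \<in> potents_on (Suc k) d (R - Id)" by blast
    have gc: "g \<in> carrier A" using g by (simp add: potents_on_def)
    have "(g [^]\<^bsub>A\<^esub> Suc k) u v = g u v" for u v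
    proof (cases "(u, v) \<in> R")
      case True
      show ?thesis
      proof (cases "u = v")
        case True
        then show ?thesis using \<open>(u, v) \<in> R\<close> R_in[of u v] pow_diag[OF gc, of u "Suc k"] g
            potents[OF d, of u] by (simp add: potents_on_def del: power_Suc)
      next
        case False
        then show ?thesis using \<open>(u, v) \<in> R\<close> g by (simp add: potents_on_def)
      qed
    next
      case False
      then show ?thesis using gc nat_pow_closed[OF gc, of "Suc k"] unfolding carrier_A by metis
    qed
    then show "g \<in> {g \<in> carrier A. g [^]\<^bsub>A\<^esub> Suc k = g}" using gc by blast
  qed
  have disj: "potents_on (Suc k) d (R - Id) \<inter> potents_on (Suc k) d' (R - Id) = {}"
    if d: "d \<in> X \<rightarrow>\<^sub>E S" "d' \<in> X \<rightarrow>\<^sub>E S" "d \<noteq> d'" for d d'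
  proof -
    obtain x where "x \<in> X" "d x \<noteq> d' x" using d(3) PiE_ext[OF d(1,2)] by blast
    then show ?thesis unfolding potents_on_def by auto
  qed
  have "num_potent A (Suc k) = card (\<Union>d\<in>X \<rightarrow>\<^sub>E S. potents_on (Suc k) d (R - Id))"
    unfolding num_potent_def eq ..
  also have "\<dots> = (\<Sum>d\<in>X \<rightarrow>\<^sub>E S. card (potents_on (Suc k) d (R - Id)))"
  proof (intro card_UN_disjoint ballI impI)
    show "finite (X \<rightarrow>\<^sub>E S)" using finite_X fS by (intro finite_PiE) auto
    show "finite (potents_on (Suc k) d (R - Id))" if "d \<in> X \<rightarrow>\<^sub>E S" for d
      using card_d[OF that] by blast
  qed (use disj in blast)
  also have "\<dots> = (\<Sum>d\<in>X \<rightarrow>\<^sub>E S. CARD('k) ^ card {(x, y) \<in> R. d x \<noteq> d y})"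
  proof (rule sum.cong[OF refl])
    fix d assume d: "d \<in> X \<rightarrow>\<^sub>E S"
    have "{(x, y) \<in> R - Id. d x \<noteq> d y} = {(x, y) \<in> R. d x \<noteq> d y}" by auto
    then show "card (potents_on (Suc k) d (R - Id)) = CARD('k) ^ card {(x, y) \<in> R. d x \<noteq> d y}"
      using card_d[OF d] by simp
  qed
  finally show ?thesis by (simp only: S_def)
qed

end

subsection \<open>Sums over value assignments on chains\<close>

text \<open>Once \<open>Y\<close> is listed as \<open>ys\<close>, an assignment becomes the word
  \<open>map d ys\<close>. Prescribed fibre sizes say that this word is an arrangement of the
  multiset \<open>M\<close> with multiplicities \<open>\<nu>\<close>, and such arrangements are
  counted by the multinomial coefficient.\<close>

lemma card_PiE_fibres:
  assumes Y: "finite Y" and S: "finite S" and \<nu>: "(\<Sum>a\<in>S. \<nu> a) = card Y"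
  shows "card {d \<in> Y \<rightarrow>\<^sub>E S. \<forall>a\<in>S. card {z \<in> Y. d z = a} = \<nu> a}
    = fact (card Y) div (\<Prod>a\<in>S. fact (\<nu> a))" (is "card ?D = _")
proof -
  obtain ys where ys: "distinct ys" "set ys = Y" using finite_distinct_list[OF Y] by blast
  have len: "length ys = card Y" using ys distinct_card by fastforce
  define M where "M = (\<Sum>a\<in>S. replicate_mset (\<nu> a) a)"
  have count_M: "count M a = (if a \<in> S then \<nu> a else 0)" for a
    unfolding M_def count_sum using S by (simp add: sum.delta)
  have set_M: "set_mset M \<subseteq> S" using count_M by (metis not_in_iff subsetI)
  have size_M: "size M = card Y" unfolding M_def size_multiset_sum by (simp add: \<nu>)
  have count_map: "count (mset (map d ys)) a = card {z \<in> Y. d z = a}" for d a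
  proof -
    have "count (mset (map d ys)) a = length (filter (\<lambda>z. d z = a) ys)"
      by (induction ys) auto
    also have "\<dots> = card (set (filter (\<lambda>z. d z = a) ys))"
      using ys by (intro distinct_card[symmetric]) simp
    finally show ?thesis by (simp add: ys)
  qed
  have "bij_betw (\<lambda>d. map d ys) ?D (permutations_of_multiset M)"
  proof (rule bij_betw_imageI)
    show "inj_on (\<lambda>d. map d ys) ?D"
    proof (rule inj_onI)
      fix d d' assume "d \<in> ?D" "d' \<in> ?D" "map d ys = map d' ys"
      then show "d = d'" using ys by (intro PiE_ext[of d Y "\<lambda>_. S" d']) auto
    qed
    show "(\<lambda>d. map d ys) ` ?D = permutations_of_multiset M"
    proof (intro equalityI subsetI)
      fix xs assume "xs \<in> (\<lambda>d. map d ys) ` ?D"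
      then obtain d where d: "d \<in> ?D" "xs = map d ys" by blast
      have "mset xs = M"
      proof (rule multiset_eqI)
        fix a
        have empty: "{z \<in> Y. d z = a} = {}" if "a \<notin> S" using that d by auto
        show "count (mset xs) a = count M a"
          unfolding d(2) count_map count_M using d(1)
          by (cases "a \<in> S") (simp, subst empty, simp_all)
      qed
      then show "xs \<in> permutations_of_multiset M" by (rule permutations_of_multisetI)
    next
      fix xs assume "xs \<in> permutations_of_multiset M"
      then have xs: "mset xs = M" by (rule permutations_of_multisetD)
      then have lx: "length ys = length xs" using size_M len by (metis size_mset)
      define d where "d = (\<lambda>z\<in>Y. the (map_of (zip ys xs) z))"
      have map_d: "map d ys = xs"
      proof (rule nth_equalityI)
        fix i assume "i < length (map d ys)"
        then show "map d ys ! i = xs ! i"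
          using map_of_zip_nth[OF lx ys(1), of i] lx ys(2) nth_mem[of i ys] by (simp add: d_def)
      qed (use lx in simp)
      have "d z \<in> S" if "z \<in> Y" for z
      proof -
        have "d z \<in> set (map d ys)" using that ys by simp
        then have "d z \<in># mset (map d ys)" by (simp only: set_mset_mset)
        then show ?thesis using set_M xs map_d by auto
      qed
      moreover have "card {z \<in> Y. d z = a} = \<nu> a" if "a \<in> S" for a
        using count_map[of d a] count_M[of a] map_d xs that by simp
      ultimately have "d \<in> ?D" by (auto simp: d_def)
      then show "xs \<in> (\<lambda>d. map d ys) ` ?D" using map_d by blast
    qed
  qed
  then have "card ?D = card (permutations_of_multiset M)" by (rule bij_betw_same_card)
  also have "\<dots> = fact (card Y) div (\<Prod>a\<in>set_mset M. fact (count M a))"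
    by (simp add: card_permutations_of_multiset size_M)
  \<comment> \<open>Values of multiplicity 0 are missing from \<open>set_mset M\<close>; they
    contribute the factor \<open>fact 0 = 1\<close>.\<close>
  also have "(\<Prod>a\<in>set_mset M. fact (count M a)) = (\<Prod>a\<in>S. fact (count M a) :: nat)"
    using set_M S by (intro prod.mono_neutral_left) (auto simp: not_in_iff)
  also have "\<dots> = (\<Prod>a\<in>S. fact (\<nu> a))" by (simp add: count_M)
  finally show ?thesis .
qed

text \<open>By totality and antisymmetry, two distinct elements of \<open>Y\<close> are related in
  exactly one direction. Orienting each pair by its \<open>e\<close>-values instead of by
  \<open>R\<close> therefore preserves the count, and the pairs with values \<open>i < j\<close>
  form a product of two fibres.\<close>

lemma card_unequal_pairs:
  fixes e :: "'a \<Rightarrow> nat"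
  assumes Y: "finite Y" and R: "total_on Y R" "antisym R" and e: "\<And>z. z \<in> Y \<Longrightarrow> e z \<in> {1..s}"
  shows "card {(x, y) \<in> R \<inter> Y \<times> Y. e x \<noteq> e y}
    = (\<Sum>(i, j) | 1 \<le> i \<and> i < j \<and> j \<le> s. card {z \<in> Y. e z = i} * card {z \<in> Y. e z = j})"
proof -
  define P where "P = {(i, j). 1 \<le> i \<and> i < j \<and> j \<le> s}"
  have "P \<subseteq> {1..s} \<times> {1..s}" by (auto simp: P_def)
  then have P: "finite P" by (rule finite_subset) simp
  have "bij_betw (\<lambda>(x, y). if e x < e y then (x, y) else (y, x))
    {(x, y) \<in> R \<inter> Y \<times> Y. e x \<noteq> e y} {(x, y) \<in> Y \<times> Y. e x < e y}" (is "bij_betw ?f ?A ?B")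
  proof (rule bij_betw_imageI)
    show "inj_on ?f ?A"
      using R(2) by (auto simp: inj_on_def antisym_def split: if_splits)
    show "?f ` ?A = ?B"
    proof (intro equalityI subsetI)
      fix p assume "p \<in> ?B"
      then obtain x y where p: "p = (x, y)" "x \<in> Y" "y \<in> Y" "e x < e y" by auto
      then have "(x, y) \<in> R \<or> (y, x) \<in> R" using R(1) unfolding total_on_def by fastforce
      then show "p \<in> ?f ` ?A"
      proof
        assume "(x, y) \<in> R"
        then show ?thesis using p by (intro image_eqI[of _ _ "(x, y)"]) auto
      next
        assume "(y, x) \<in> R"
        then show ?thesis using p by (intro image_eqI[of _ _ "(y, x)"]) auto
      qed
    qed (auto split: if_splits)
  qed
  then have "card ?A = card ?B" by (rule bij_betw_same_card)
  also have "?B = (\<Union>p\<in>P. {z \<in> Y. e z = fst p} \<times> {z \<in> Y. e z = snd p})"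
    using e by (fastforce simp: P_def)
  also have "card \<dots> = (\<Sum>p\<in>P. card ({z \<in> Y. e z = fst p} \<times> {z \<in> Y. e z = snd p}))"
    using P Y by (intro card_UN_disjoint) (auto simp: prod_eq_iff)
  also have "\<dots> = (\<Sum>(i, j)\<in>P. card {z \<in> Y. e z = i} * card {z \<in> Y. e z = j})"
    by (simp add: card_cartesian_product case_prod_beta)
  finally show ?thesis by (simp add: P_def)
qed

text \<open>The assignments are grouped by their vector \<open>\<phi> e\<close> of fibre sizes. The
  weight depends on this vector alone, and each group has multinomial size. The index 1 stands for
  the value at the glued least element, which is why the linear part of the exponent starts at
  \<open>i = 2\<close>.\<close>

lemma sum_chain_index:
  assumes Y: "finite Y" and R: "total_on Y R" "antisym R" and s: "s \<ge> 1"
  shows "(\<Sum>e\<in>Y \<rightarrow>\<^sub>E {1..s}.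
      q ^ (card {z \<in> Y. e z \<noteq> 1} + card {(x, y) \<in> R \<inter> Y \<times> Y. e x \<noteq> e y}))
    = potent_factor q s (card Y)"
proof -
  define T where "T = {\<mu>. \<mu> \<in> {1..s} \<rightarrow>\<^sub>E UNIV \<and> (\<Sum>i=1..s. \<mu> i) = card Y}"
  define \<phi> where "\<phi> e = (\<lambda>i\<in>{1..s}. card {z \<in> Y. e z = i})" for e :: "'a \<Rightarrow> nat"
  define w where "w e = q ^ (card {z \<in> Y. e z \<noteq> 1} + card {(x, y) \<in> R \<inter> Y \<times> Y. e x \<noteq> e y})"
    for e :: "'a \<Rightarrow> nat"
  have fT: "finite T"
  proof (rule finite_subset)
    show "T \<subseteq> {1..s} \<rightarrow>\<^sub>E {..card Y}"
    proof
      fix \<mu> assume \<mu>: "\<mu> \<in> T"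
      have "\<mu> i \<le> card Y" if "i \<in> {1..s}" for i
        using member_le_sum[OF that, of \<mu>] \<mu> by (simp add: T_def)
      then show "\<mu> \<in> {1..s} \<rightarrow>\<^sub>E {..card Y}" using \<mu> by (auto simp: T_def PiE_iff)
    qed
  qed (intro finite_PiE, auto)
  have sum_fibres: "(\<Sum>i\<in>J. card {z \<in> Y. e z = i}) = card {z \<in> Y. e z \<in> J}"
    if "finite J" for e :: "'a \<Rightarrow> nat" and J
  proof -
    have "card {z \<in> Y. e z \<in> J} = card (\<Union>i\<in>J. {z \<in> Y. e z = i})"
      by (rule arg_cong[where f = card]) auto
    also have "\<dots> = (\<Sum>i\<in>J. card {z \<in> Y. e z = i})"
      using that Y by (intro card_UN_disjoint) auto
    finally show ?thesis ..
  qed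
  have "(\<Sum>e\<in>Y \<rightarrow>\<^sub>E {1..s}. w e) = (\<Sum>\<mu>\<in>T. \<Sum>e | e \<in> Y \<rightarrow>\<^sub>E {1..s} \<and> \<phi> e = \<mu>. w e)"
  proof (rule sum.group[symmetric])
    show "finite (Y \<rightarrow>\<^sub>E {1..s})" using Y by (intro finite_PiE) auto
    show "\<phi> ` (Y \<rightarrow>\<^sub>E {1..s}) \<subseteq> T"
    proof clarify
      fix e assume e: "e \<in> Y \<rightarrow>\<^sub>E {1..s}"
      then have "{z \<in> Y. e z \<in> {1..s}} = Y" by auto
      then show "\<phi> e \<in> T" using sum_fibres[of "{1..s}" e] by (simp add: T_def \<phi>_def)
    qed
  qed (rule fT)
  also have "\<dots> = (\<Sum>\<mu>\<in>T. multinomial (card Y) s \<mu>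
        * q ^ (\<Sum>(i, j) | 1 \<le> i \<and> i < j \<and> j \<le> s. \<mu> i * \<mu> j)
        * q ^ (\<Sum>i=2..s. \<mu> i))"
  proof (rule sum.cong[OF refl])
    fix \<mu> assume \<mu>: "\<mu> \<in> T"
    let ?E = "{e. e \<in> Y \<rightarrow>\<^sub>E {1..s} \<and> \<phi> e = \<mu>}"
    have "w e = q ^ (\<Sum>(i, j) | 1 \<le> i \<and> i < j \<and> j \<le> s. \<mu> i * \<mu> j) * q ^ (\<Sum>i=2..s. \<mu> i)"
      if e: "e \<in> ?E" for e
    proof -
      have eY: "e z \<in> {1..s}" if "z \<in> Y" for z using e that by auto
      have \<mu>e: "\<mu> i = card {z \<in> Y. e z = i}" if "i \<in> {1..s}" for i
        using e that by (auto simp: \<phi>_def)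
      have "{z \<in> Y. e z \<noteq> 1} = {z \<in> Y. e z \<in> {2..s}}" using eY by fastforce
      then have "card {z \<in> Y. e z \<noteq> 1} = (\<Sum>i=2..s. card {z \<in> Y. e z = i})"
        using sum_fibres[of "{2..s}" e] by simp
      also have "\<dots> = (\<Sum>i=2..s. \<mu> i)" using \<mu>e by (intro sum.cong) auto
      finally have 1: "card {z \<in> Y. e z \<noteq> 1} = (\<Sum>i=2..s. \<mu> i)" .
      have 2: "card {(x, y) \<in> R \<inter> Y \<times> Y. e x \<noteq> e y}
        = (\<Sum>(i, j) | 1 \<le> i \<and> i < j \<and> j \<le> s. \<mu> i * \<mu> j)"
      proof -
        have "card {(x, y) \<in> R \<inter> Y \<times> Y. e x \<noteq> e y}
          = (\<Sum>(i, j) | 1 \<le> i \<and> i < j \<and> j \<le> s. card {z \<in> Y. e z = i} * card {z \<in> Y. e z = j})"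
          by (rule card_unequal_pairs[OF Y R eY])
        also have "\<dots> = (\<Sum>(i, j) | 1 \<le> i \<and> i < j \<and> j \<le> s. \<mu> i * \<mu> j)"
          using \<mu>e by (intro sum.cong) auto
        finally show ?thesis .
      qed
      show ?thesis unfolding w_def 1 2 by (simp add: power_add)
    qed
    moreover have "card ?E = multinomial (card Y) s \<mu>"
    proof -
      have "?E = {e \<in> Y \<rightarrow>\<^sub>E {1..s}. \<forall>i\<in>{1..s}. card {z \<in> Y. e z = i} = \<mu> i}"
      proof -
        have "\<phi> e = \<mu> \<longleftrightarrow> (\<forall>i\<in>{1..s}. card {z \<in> Y. e z = i} = \<mu> i)" for e
        proof
          assume "\<forall>i\<in>{1..s}. card {z \<in> Y. e z = i} = \<mu> i"
          then have "\<phi> e i = \<mu> i" for i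
            using \<mu> by (cases "i \<in> {1..s}") (auto simp: \<phi>_def T_def PiE_iff extensional_def)
          then show "\<phi> e = \<mu>" by blast
        qed (auto simp: \<phi>_def)
        then show ?thesis by blast
      qed
      then show ?thesis
        using card_PiE_fibres[OF Y, of "{1..s}" \<mu>] \<mu> by (simp add: multinomial_def T_def)
    qed
    ultimately show "(\<Sum>e\<in>?E. w e) = multinomial (card Y) s \<mu>
        * q ^ (\<Sum>(i, j) | 1 \<le> i \<and> i < j \<and> j \<le> s. \<mu> i * \<mu> j)
        * q ^ (\<Sum>i=2..s. \<mu> i)" by simp
  qed
  finally show ?thesis by (simp add: w_def potent_factor_def T_def)
qed

text \<open>The weight only sees which values coincide and which equal \<open>c\<close>. Numbering
  \<open>S\<close> by \<open>1, ..., s\<close> with \<open>c\<close> as number 1 reduces the sum to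
  indices, so the result is the same for every \<open>c\<close>.\<close>

lemma sum_chain:
  assumes Y: "finite Y" and R: "total_on Y R" "antisym R" and S: "finite S" "c \<in> S"
  shows "(\<Sum>d\<in>Y \<rightarrow>\<^sub>E S.
      q ^ (card {z \<in> Y. d z \<noteq> c} + card {(x, y) \<in> R \<inter> Y \<times> Y. d x \<noteq> d y}))
    = potent_factor q (card S) (card Y)"
proof -
  define s where "s = card S"
  have s: "s \<ge> 1" using S by (auto simp: s_def Suc_le_eq card_gt_0_iff)
  have "card {2..s} = card (S - {c})" using S by (simp add: s_def)
  then obtain h0 where h0: "bij_betw h0 {2..s} (S - {c})"
    using S(1) by (metis finite_same_card_bij finite_atLeastAtMost finite_Diff)
  \<comment> \<open>The numbering \<open>h0\<close> covers the values other than \<open>c\<close> by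
    \<open>{2..s}\<close>; the index 1 is reserved for \<open>c\<close>.\<close>
  define h where "h = h0(1 := c)"
  have h: "bij_betw h {1..s} S"
  proof -
    have "bij_betw h {2..s} (S - {c})" using h0 by (rule bij_betw_cong[THEN iffD1, rotated]) (auto simp: h_def)
    then have "bij_betw h ({2..s} \<union> {1}) ((S - {c}) \<union> {h 1})"
      by (intro notIn_Un_bij_betw) (auto simp: h_def)
    moreover have "{2..s} \<union> {1} = {1..s}" "(S - {c}) \<union> {h 1} = S"
      using s S by (auto simp: h_def)
    ultimately show ?thesis by simp
  qed
  have h1: "h 1 = c" by (simp add: h_def)
  have h_eq: "h i = h j \<longleftrightarrow> i = j" if "i \<in> {1..s}" "j \<in> {1..s}" for i j
    using h that by (auto simp: bij_betw_def dest: inj_onD)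
  have h_in: "h i \<in> S" if "i \<in> {1..s}" for i using h that by (auto simp: bij_betw_def)
  let ?g = "inv_into {1..s} h"
  have g: "?g a \<in> {1..s}" "h (?g a) = a" if "a \<in> S" for a
    using h that by (auto simp: bij_betw_def intro: inv_into_into f_inv_into_f)
  have gh: "?g (h i) = i" if "i \<in> {1..s}" for i using h that by (simp add: bij_betw_def)
  have "(\<Sum>d\<in>Y \<rightarrow>\<^sub>E S. q ^ (card {z \<in> Y. d z \<noteq> c} + card {(x, y) \<in> R \<inter> Y \<times> Y. d x \<noteq> d y}))
    = (\<Sum>e\<in>Y \<rightarrow>\<^sub>E {1..s}. q ^ (card {z \<in> Y. e z \<noteq> 1} + card {(x, y) \<in> R \<inter> Y \<times> Y. e x \<noteq> e y}))"
  proof (rule sum.reindex_bij_witness[where i = "\<lambda>e. \<lambda>z\<in>Y. h (e z)" and j = "\<lambda>d. \<lambda>z\<in>Y. ?g (d z)"])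
    fix d assume d: "d \<in> Y \<rightarrow>\<^sub>E S"
    have dY: "d z \<in> S" if "z \<in> Y" for z using d that by auto
    show "(\<lambda>z\<in>Y. h ((\<lambda>z\<in>Y. ?g (d z)) z)) = d"
      by (intro PiE_ext[OF _ d]) (auto simp: g(2) dY simp del: One_nat_def)
    show "(\<lambda>z\<in>Y. ?g (d z)) \<in> Y \<rightarrow>\<^sub>E {1..s}" using dY g(1) by auto
    have "?g (d x) = ?g (d y) \<longleftrightarrow> d x = d y" if "x \<in> Y" "y \<in> Y" for x y
      using g(2)[OF dY[OF that(1)]] g(2)[OF dY[OF that(2)]] by metis
    then have 1: "{(x, y) \<in> R \<inter> Y \<times> Y. (\<lambda>z\<in>Y. ?g (d z)) x \<noteq> (\<lambda>z\<in>Y. ?g (d z)) y}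
      = {(x, y) \<in> R \<inter> Y \<times> Y. d x \<noteq> d y}" by auto
    have "?g (d z) = 1 \<longleftrightarrow> d z = c" if "z \<in> Y" for z
      using g(2)[OF dY[OF that]] gh[of 1] h1 s by auto
    then have 2: "{z \<in> Y. (\<lambda>z\<in>Y. ?g (d z)) z \<noteq> 1} = {z \<in> Y. d z \<noteq> c}" by auto
    show "q ^ (card {z \<in> Y. (\<lambda>z\<in>Y. ?g (d z)) z \<noteq> 1}
        + card {(x, y) \<in> R \<inter> Y \<times> Y. (\<lambda>z\<in>Y. ?g (d z)) x \<noteq> (\<lambda>z\<in>Y. ?g (d z)) y})
      = q ^ (card {z \<in> Y. d z \<noteq> c} + card {(x, y) \<in> R \<inter> Y \<times> Y. d x \<noteq> d y})"
      unfolding 1 2 ..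
  next
    fix e assume e: "e \<in> Y \<rightarrow>\<^sub>E {1..s}"
    then have eY: "e z \<in> {1..s}" if "z \<in> Y" for z using that by auto
    show "(\<lambda>z\<in>Y. h (e z)) \<in> Y \<rightarrow>\<^sub>E S" using eY h_in by auto
    then show "(\<lambda>z\<in>Y. ?g ((\<lambda>z\<in>Y. h (e z)) z)) = e"
      using eY gh by (intro PiE_ext[OF _ e]) (auto simp del: One_nat_def)
  qed
  then show ?thesis using sum_chain_index[OF Y R s, of q] by (simp add: s_def)
qed

text \<open>Restriction to \<open>A\<close> and to \<open>B\<close> identifies a map on the union
  with a pair of maps. As \<open>f\<close> and \<open>g\<close> each read only their own part, the
  sum is a product by distributivity.\<close>

lemma sum_PiE_Un:
  fixes f :: "('a \<Rightarrow> 'b) \<Rightarrow> 'c::comm_semiring_0"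
  assumes AB: "A \<inter> B = {}"
    and f: "\<And>d d'. (\<And>z. z \<in> A \<Longrightarrow> d z = d' z) \<Longrightarrow> f d = f d'"
    and g: "\<And>d d'. (\<And>z. z \<in> B \<Longrightarrow> d z = d' z) \<Longrightarrow> g d = g d'"
  shows "(\<Sum>d\<in>A \<union> B \<rightarrow>\<^sub>E S. f d * g d) = (\<Sum>d\<in>A \<rightarrow>\<^sub>E S. f d) * (\<Sum>d\<in>B \<rightarrow>\<^sub>E S. g d)"
proof -
  have "(\<Sum>d\<in>A \<union> B \<rightarrow>\<^sub>E S. f d * g d)
    = (\<Sum>(d, d')\<in>(A \<rightarrow>\<^sub>E S) \<times> (B \<rightarrow>\<^sub>E S). f d * g d')"
  proof (rule sum.reindex_bij_witness[where i = "\<lambda>(d, d') z. if z \<in> A then d z else d' z"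
        and j = "\<lambda>d. (restrict d A, restrict d B)"])
    fix d assume d: "d \<in> A \<union> B \<rightarrow>\<^sub>E S"
    show "(case (restrict d A, restrict d B) of (d, d') \<Rightarrow> \<lambda>z. if z \<in> A then d z else d' z) = d"
      using d by (auto simp: fun_eq_iff PiE_iff extensional_def)
    show "(restrict d A, restrict d B) \<in> (A \<rightarrow>\<^sub>E S) \<times> (B \<rightarrow>\<^sub>E S)" using d by auto
    have "f (restrict d A) = f d" "g (restrict d B) = g d" by (auto intro: f g)
    then show "(case (restrict d A, restrict d B) of (d, d') \<Rightarrow> f d * g d') = f d * g d" by simp
  next
    fix p assume p: "p \<in> (A \<rightarrow>\<^sub>E S) \<times> (B \<rightarrow>\<^sub>E S)"
    obtain d d' where dd: "p = (d, d')" by (cases p)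
    show "(restrict (case p of (d, d') \<Rightarrow> \<lambda>z. if z \<in> A then d z else d' z) A,
       restrict (case p of (d, d') \<Rightarrow> \<lambda>z. if z \<in> A then d z else d' z) B) = p"
      using p AB unfolding dd by (auto simp: fun_eq_iff PiE_iff extensional_def restrict_def)
    show "(case p of (d, d') \<Rightarrow> \<lambda>z. if z \<in> A then d z else d' z) \<in> A \<union> B \<rightarrow>\<^sub>E S"
      using p AB unfolding dd by (auto simp: PiE_iff extensional_def)
  qed
  also have "\<dots> = (\<Sum>d\<in>A \<rightarrow>\<^sub>E S. f d) * (\<Sum>d\<in>B \<rightarrow>\<^sub>E S. g d)"
    by (simp add: sum_product sum.cartesian_product)
  finally show ?thesis .
qed

lemma sum_PiE_UN:
  fixes f :: "'i \<Rightarrow> ('a \<Rightarrow> 'b) \<Rightarrow> 'c::comm_semiring_1"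
  assumes "finite I" and "\<And>i j. i \<in> I \<Longrightarrow> j \<in> I \<Longrightarrow> i \<noteq> j \<Longrightarrow> Y i \<inter> Y j = {}"
    and f: "\<And>i d d'. (\<And>z. z \<in> Y i \<Longrightarrow> d z = d' z) \<Longrightarrow> f i d = f i d'"
  shows "(\<Sum>d\<in>(\<Union>i\<in>I. Y i) \<rightarrow>\<^sub>E S. \<Prod>i\<in>I. f i d) = (\<Prod>i\<in>I. \<Sum>d\<in>Y i \<rightarrow>\<^sub>E S. f i d)"
  using assms(1,2)
proof (induction I rule: finite_induct)
  case empty
  then show ?case by simp
next
  case (insert i I)
  have "Y i \<inter> Y j = {}" if "j \<in> I" for j
    using insert.hyps(2) that by (intro insert.prems) auto
  then have disj: "Y i \<inter> (\<Union>j\<in>I. Y j) = {}" by blast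
  have "(\<Sum>d\<in>(\<Union>j\<in>insert i I. Y j) \<rightarrow>\<^sub>E S. \<Prod>j\<in>insert i I. f j d)
    = (\<Sum>d\<in>Y i \<union> (\<Union>j\<in>I. Y j) \<rightarrow>\<^sub>E S. f i d * (\<Prod>j\<in>I. f j d))"
    using insert.hyps by simp
  also have "\<dots> = (\<Sum>d\<in>Y i \<rightarrow>\<^sub>E S. f i d) * (\<Sum>d\<in>(\<Union>j\<in>I. Y j) \<rightarrow>\<^sub>E S. \<Prod>j\<in>I. f j d)"
  proof (rule sum_PiE_Un[OF disj])
    show "f i d = f i d'" if "\<And>z. z \<in> Y i \<Longrightarrow> d z = d' z" for d d'
      using that by (rule f)
    show "(\<Prod>j\<in>I. f j d) = (\<Prod>j\<in>I. f j d')" if "\<And>z. z \<in> (\<Union>j\<in>I. Y j) \<Longrightarrow> d z = d' z" for d d'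
      using that by (intro prod.cong refl f) auto
  qed
  also have "\<dots> = (\<Prod>j\<in>insert i I. \<Sum>d\<in>Y j \<rightarrow>\<^sub>E S. f j d)"
    using insert by simp
  finally show ?case .
qed

subsection \<open>Chains glued at their least element\<close>

context finite_poset
begin

text \<open>The sets \<open>Y i\<close> are the legs without the common point \<open>x0\<close>. An
  unequal pair either starts at \<open>x0\<close> or stays inside one leg, so for a fixed value at
  \<open>x0\<close> the weight is a product over the legs. The factor of a leg does not depend on
  that value, and summing over it gives the leading cardinality.\<close>

theorem num_potent_spider:
  assumes K: "finite (UNIV :: 'k set)" and k: "k \<ge> 1" "of_nat k \<noteq> (0 :: 'k)"
    and I: "finite I" and X: "X = insert x0 (\<Union>i\<in>I. Y i)" and x0: "\<And>i. i \<in> I \<Longrightarrow> x0 \<notin> Y i"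
    and least: "\<And>z. z \<in> X \<Longrightarrow> (x0, z) \<in> R"
    and total: "\<And>i. i \<in> I \<Longrightarrow> total_on (Y i) R"
    and disj: "\<And>i j. i \<in> I \<Longrightarrow> j \<in> I \<Longrightarrow> i \<noteq> j \<Longrightarrow> Y i \<inter> Y j = {}"
    and incomparable: "\<And>i j u v. i \<in> I \<Longrightarrow> j \<in> I \<Longrightarrow> i \<noteq> j \<Longrightarrow> u \<in> Y i \<Longrightarrow> v \<in> Y j \<Longrightarrow> (u, v) \<notin> R"
  shows "num_potent A (Suc k) = card {a :: 'k. a ^ Suc k = a}
    * (\<Prod>i\<in>I. potent_factor CARD('k) (card {a :: 'k. a ^ Suc k = a}) (card (Y i)))"
proof -
  define S where "S = {a :: 'k. a ^ Suc k = a}"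
  define U where "U = (\<Union>i\<in>I. Y i)"
  \<comment> \<open>The first summand counts the unequal pairs from \<open>x0\<close>, with value
    \<open>c\<close>, into the leg; the second counts those within the leg.\<close>
  define leg where "leg c i d = card {z \<in> Y i. d z \<noteq> c} + card {(x, y) \<in> R \<inter> Y i \<times> Y i. d x \<noteq> d y}"
    for c :: 'k and i and d :: "'a \<Rightarrow> 'k"
  have fS: "finite S" using K by (rule finite_subset[rotated]) simp
  have x0U: "x0 \<notin> U" using x0 by (auto simp: U_def)
  have fY: "finite (Y i)" if "i \<in> I" for i
    using finite_X that by (rule_tac finite_subset[of _ X]) (auto simp: X)
  have antisym: "antisym R" using po by (simp add: partial_order_on_def)
  have exponent: "card {(x, y) \<in> R. d x \<noteq> d y} = (\<Sum>i\<in>I. leg (d x0) i d)" for d :: "'a \<Rightarrow> 'k"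
  proof -
    define B where "B i = {x0} \<times> {z \<in> Y i. d z \<noteq> d x0} \<union> {(x, y) \<in> R \<inter> Y i \<times> Y i. d x \<noteq> d y}" for i
    have "{(x, y) \<in> R. d x \<noteq> d y} = (\<Union>i\<in>I. B i)"
    proof (intro equalityI subsetI)
      fix p assume "p \<in> {(x, y) \<in> R. d x \<noteq> d y}"
      then obtain u v where p: "p = (u, v)" "(u, v) \<in> R" "d u \<noteq> d v" by blast
      have uv: "u \<in> X" "v \<in> X" using R_in[OF p(2)] by auto
      \<comment> \<open>Nothing lies strictly below the least element \<open>x0\<close>, so the
        upper end of an unequal pair belongs to a leg, which then determines the part
        \<open>B j\<close>.\<close>
      have "v \<noteq> x0"
        using R_antisym[OF p(2)] least[OF uv(1)] p(3) by auto
      then obtain j where j: "j \<in> I" "v \<in> Y j" using uv(2) by (auto simp: X)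
      show "p \<in> (\<Union>i\<in>I. B i)"
      proof (cases "u = x0")
        case True
        then show ?thesis using p j by (auto simp: B_def)
      next
        case False
        then obtain i where i: "i \<in> I" "u \<in> Y i" using uv(1) by (auto simp: X)
        then have "i = j" using incomparable[of i j u v] j p by blast
        then show ?thesis using p i j by (auto simp: B_def)
      qed
    next
      fix p assume "p \<in> (\<Union>i\<in>I. B i)"
      then show "p \<in> {(x, y) \<in> R. d x \<noteq> d y}" using least by (auto simp: B_def X)
    qed
    then have "card {(x, y) \<in> R. d x \<noteq> d y} = card (\<Union>i\<in>I. B i)" by simp
    also have "\<dots> = (\<Sum>i\<in>I. card (B i))"
    proof (intro card_UN_disjoint ballI impI)
      show "finite (B i)" if "i \<in> I" for i
      proof (rule finite_subset)
        show "B i \<subseteq> insert x0 (Y i) \<times> Y i" by (auto simp: B_def)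
      qed (use fY that in simp)
      show "B i \<inter> B j = {}" if "i \<in> I" "j \<in> I" "i \<noteq> j" for i j
        using disj[OF that] by (auto simp: B_def)
    qed (rule I)
    also have "\<dots> = (\<Sum>i\<in>I. leg (d x0) i d)"
    proof (rule sum.cong[OF refl])
      fix i assume i: "i \<in> I"
      have "finite {(x, y) \<in> R \<inter> Y i \<times> Y i. d x \<noteq> d y}"
        using fY[OF i] by (rule_tac finite_subset[of _ "Y i \<times> Y i"]) auto
      then show "card (B i) = leg (d x0) i d"
        unfolding B_def leg_def using x0[OF i] fY[OF i]
        by (subst card_Un_disjoint) (auto simp: card_cartesian_product)
    qed
    finally show ?thesis .
  qed
  have leg_cong: "leg c i d = leg c i d'" if "\<And>z. z \<in> Y i \<Longrightarrow> d z = d' z" for c i d d'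
  proof -
    have "{z \<in> Y i. d z \<noteq> c} = {z \<in> Y i. d' z \<noteq> c}"
      "{(x, y) \<in> R \<inter> Y i \<times> Y i. d x \<noteq> d y} = {(x, y) \<in> R \<inter> Y i \<times> Y i. d' x \<noteq> d' y}"
      using that by auto
    then show ?thesis by (simp add: leg_def)
  qed
  have "num_potent A (Suc k) = (\<Sum>d\<in>insert x0 U \<rightarrow>\<^sub>E S. CARD('k) ^ card {(x, y) \<in> R. d x \<noteq> d y})"
    unfolding num_potent_eq_sum[OF K k] by (simp only: S_def U_def X)
  also have "\<dots> = (\<Sum>d\<in>insert x0 U \<rightarrow>\<^sub>E S. CARD('k) ^ (\<Sum>i\<in>I. leg (d x0) i d))"
    by (simp only: exponent)
  \<comment> \<open>The value \<open>c\<close> at \<open>x0\<close> is separated from the assignment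
    \<open>d\<close> on the legs.\<close>
  also have "\<dots> = (\<Sum>(c, d)\<in>S \<times> (U \<rightarrow>\<^sub>E S). CARD('k) ^ (\<Sum>i\<in>I. leg c i d))"
    unfolding PiE_insert_eq
  proof (subst sum.reindex)
    show "inj_on (\<lambda>(y, g). g(x0 := y)) (S \<times> (U \<rightarrow>\<^sub>E S))" using x0U by (rule inj_combinator)
    have "leg c i (d(x0 := c)) = leg c i d" if "i \<in> I" for c i d
      using x0[OF that] by (intro leg_cong) auto
    then show "(\<Sum>p\<in>S \<times> (U \<rightarrow>\<^sub>E S).
        ((\<lambda>d. CARD('k) ^ (\<Sum>i\<in>I. leg (d x0) i d)) \<circ> (\<lambda>(y, g). g(x0 := y))) p)
      = (\<Sum>(c, d)\<in>S \<times> (U \<rightarrow>\<^sub>E S). CARD('k) ^ (\<Sum>i\<in>I. leg c i d))"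
      by (intro sum.cong) auto
  qed
  also have "\<dots> = (\<Sum>c\<in>S. \<Sum>d\<in>U \<rightarrow>\<^sub>E S. \<Prod>i\<in>I. CARD('k) ^ leg c i d)"
    by (simp add: sum.cartesian_product power_sum)
  also have "\<dots> = (\<Sum>c\<in>S. \<Prod>i\<in>I. potent_factor CARD('k) (card S) (card (Y i)))"
  proof (rule sum.cong[OF refl])
    fix c assume c: "c \<in> S"
    have "(\<Sum>d\<in>U \<rightarrow>\<^sub>E S. \<Prod>i\<in>I. CARD('k) ^ leg c i d)
      = (\<Prod>i\<in>I. \<Sum>d\<in>Y i \<rightarrow>\<^sub>E S. CARD('k) ^ leg c i d)"
      unfolding U_def
    proof (rule sum_PiE_UN[OF I])
      show "Y i \<inter> Y j = {}" if "i \<in> I" "j \<in> I" "i \<noteq> j" for i j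
        using that by (rule disj)
      show "CARD('k) ^ leg c i d = CARD('k) ^ leg c i d'" if "\<And>z. z \<in> Y i \<Longrightarrow> d z = d' z" for i d d'
        using leg_cong[OF that] by simp
    qed
    also have "\<dots> = (\<Prod>i\<in>I. potent_factor CARD('k) (card S) (card (Y i)))"
      unfolding leg_def using sum_chain[OF fY total antisym fS c] by (intro prod.cong) auto
    finally show "(\<Sum>d\<in>U \<rightarrow>\<^sub>E S. \<Prod>i\<in>I. CARD('k) ^ leg c i d)
      = (\<Prod>i\<in>I. potent_factor CARD('k) (card S) (card (Y i)))" .
  qed
  finally show ?thesis by (simp add: S_def)
qed

end

section \<open>Transfer to upper triangular matrices\<close>

lemma num_potent_iso:
  assumes f: "bij_betw f (carrier G) (carrier H)" and G: "monoid G"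
    and mult: "\<And>x y. x \<in> carrier G \<Longrightarrow> y \<in> carrier G \<Longrightarrow> f (x \<otimes>\<^bsub>G\<^esub> y) = f x \<otimes>\<^bsub>H\<^esub> f y"
    and one: "f \<one>\<^bsub>G\<^esub> = \<one>\<^bsub>H\<^esub>"
  shows "num_potent G n = num_potent H n"
proof -
  interpret monoid G by (rule G)
  have pow: "f (g [^]\<^bsub>G\<^esub> (n::nat)) = f g [^]\<^bsub>H\<^esub> n" if "g \<in> carrier G" for g n
    using that by (induction n) (simp_all add: one mult nat_pow_def[of H])
  have "f (g [^]\<^bsub>G\<^esub> n) = f g \<longleftrightarrow> g [^]\<^bsub>G\<^esub> n = g" if "g \<in> carrier G" for g
    using f that by (auto simp: bij_betw_def dest: inj_onD)
  then have iff: "f g [^]\<^bsub>H\<^esub> n = f g \<longleftrightarrow> g [^]\<^bsub>G\<^esub> n = g" if "g \<in> carrier G" for g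
    using that pow by simp
  have "bij_betw f {g \<in> carrier G. g [^]\<^bsub>G\<^esub> n = g} {h \<in> carrier H. h [^]\<^bsub>H\<^esub> n = h}"
    using f iff by (rule bij_betw_Collect)
  then show ?thesis unfolding num_potent_def by (rule bij_betw_same_card)
qed

text \<open>Convolution on the chain \<open>0 < ... < n - 1\<close> is matrix multiplication, and
  vanishing off the order is upper triangularity.\<close>

lemma num_potent_UT:
  "num_potent (UT ty n) N
    = num_potent (incidence_algebra (ty :: 'k::field itself) {..<n} {(i, j). i \<le> j \<and> j < n}) N"
proof -
  define R where "R = {(i, j). i \<le> j \<and> j < n}"
  have "partial_order_on {..<n} R"
    by (auto simp: R_def partial_order_on_def preorder_on_def refl_on_def trans_def antisym_def)
  then interpret finite_poset ty "{..<n}" R by unfold_locales simp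
  have R: "(i, j) \<in> R \<longleftrightarrow> i \<le> j \<and> j < n" for i j by (simp add: R_def)
  define f where "f g = mat n n (\<lambda>(i, j). g i j)" for g :: "nat \<Rightarrow> nat \<Rightarrow> 'k"
  have "bij_betw f (carrier A) (carrier (UT ty n))"
  \<comment> \<open>The inverse must return 0 outside the index range, where a matrix entry has no
    prescribed value.\<close>
  proof (rule bij_betwI[where g = "\<lambda>M i j. if i \<le> j \<and> j < n then M $$ (i, j) else 0"])
    show "f \<in> carrier A \<rightarrow> carrier (UT ty n)"
      by (auto simp: f_def UT_def carrier_A R)
    show "(\<lambda>M i j. if i \<le> j \<and> j < n then M $$ (i, j) else 0) \<in> carrier (UT ty n) \<rightarrow> carrier A"
      by (auto simp: carrier_A R)
    show "(\<lambda>i j. if i \<le> j \<and> j < n then f g $$ (i, j) else 0) = g" if "g \<in> carrier A" for g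
      using that by (auto simp: fun_eq_iff f_def carrier_A R)
    show "f (\<lambda>i j. if i \<le> j \<and> j < n then M $$ (i, j) else 0) = M" if "M \<in> carrier (UT ty n)" for M
      using that by (auto simp: f_def UT_def upper_triangular_def intro!: eq_matI)
  qed
  moreover have "f (g \<otimes>\<^bsub>A\<^esub> h) = f g \<otimes>\<^bsub>UT ty n\<^esub> f h" if "g \<in> carrier A" "h \<in> carrier A" for g h
    using mult_A[OF that]
    by (auto simp: f_def UT_def ring_mat_def scalar_prod_def atLeast0LessThan intro!: eq_matI sum.cong)
  moreover have "f \<one>\<^bsub>A\<^esub> = \<one>\<^bsub>UT ty n\<^esub>"
    by (auto simp: f_def UT_def ring_mat_def one_A intro!: eq_matI)
  ultimately have "num_potent A N = num_potent (UT ty n) N"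
    using monoid_axioms by (intro num_potent_iso[of f]) auto
  then show ?thesis by (simp add: R_def)
qed

section \<open>The order relation of the fork\<close>

lemma fork_set_iff:
  "u \<in> fork_set n m x y \<longleftrightarrow> (\<exists>i\<le>n. u = x i) \<or> (\<exists>j\<ge>1. j \<le> m \<and> u = y j)"
  by (auto simp: fork_set_def)

text \<open>Letting the first chain start at index 0 absorbs the pairs from \<open>x 0\<close> into
  it, and weak inequalities of indices absorb the reflexive pairs. Three cases remain for later case
  analyses.\<close>

lemma fork_rel_iff:
  "(u, v) \<in> fork_rel n m x y \<longleftrightarrow>
    (\<exists>i j. u = x i \<and> v = x j \<and> i \<le> j \<and> j \<le> n)
    \<or> (\<exists>j. u = x 0 \<and> v = y j \<and> 1 \<le> j \<and> j \<le> m)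
    \<or> (\<exists>i j. u = y i \<and> v = y j \<and> 1 \<le> i \<and> i \<le> j \<and> j \<le> m)" (is "_ \<longleftrightarrow> ?R")
proof
  assume "(u, v) \<in> fork_rel n m x y"
  then have "(u = v \<and> u \<in> fork_set n m x y)
    \<or> (\<exists>i. u = x 0 \<and> v = x i \<and> 1 \<le> i \<and> i \<le> n)
    \<or> (\<exists>i j. u = x i \<and> v = x j \<and> 1 \<le> i \<and> i \<le> j \<and> j \<le> n)
    \<or> (\<exists>i. u = x 0 \<and> v = y i \<and> 1 \<le> i \<and> i \<le> m)
    \<or> (\<exists>i j. u = y i \<and> v = y j \<and> 1 \<le> i \<and> i \<le> j \<and> j \<le> m)"
    by (simp only: fork_rel_def Un_iff Id_on_iff mem_Collect_eq prod.inject disj_assoc conj_assoc)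
  then show ?R
  proof (elim disjE exE conjE, goal_cases)
    case 1
    then show ?case unfolding fork_set_iff by blast
  next
    case (2 i)
    then show ?case by blast
  qed blast+
next
  assume ?R
  then show "(u, v) \<in> fork_rel n m x y"
  proof (elim disjE exE conjE, goal_cases)
    case (1 i j)
    \<comment> \<open>These cases correspond to three clauses of the definition: reflexivity at
      \<open>x 0\<close>, pairs above \<open>x 0\<close>, and pairs within the chain from index 1
      on.\<close>
    consider "i = 0" "j = 0" | "i = 0" "1 \<le> j" | "1 \<le> i" by linarith
    then show ?case
    proof cases
      case 1
      then show ?thesis using \<open>u = x i\<close> \<open>v = x j\<close> by (auto simp: fork_rel_def fork_set_def)
    next
      case 2
      then have "(u, v) \<in> {(x 0, x i) | i. 1 \<le> i \<and> i \<le> n}"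
        using \<open>u = x i\<close> \<open>v = x j\<close> \<open>j \<le> n\<close> by blast
      then show ?thesis by (simp add: fork_rel_def)
    next
      case 3
      then have "(u, v) \<in> {(x i, x j) | i j. 1 \<le> i \<and> i \<le> j \<and> j \<le> n}"
        using \<open>u = x i\<close> \<open>v = x j\<close> \<open>i \<le> j\<close> \<open>j \<le> n\<close> by blast
      then show ?thesis by (simp add: fork_rel_def)
    qed
  next
    case (2 j)
    then have "(u, v) \<in> {(x 0, y i) | i. 1 \<le> i \<and> i \<le> m}" by blast
    then show ?case by (simp add: fork_rel_def)
  next
    case (3 i j)
    then have "(u, v) \<in> {(y i, y j) | i j. 1 \<le> i \<and> i \<le> j \<and> j \<le> m}" by blast
    then show ?case by (simp add: fork_rel_def)
  qed
qed

section \<open>Specialisation to forks and to unions of chains\<close>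

theorem theorem1p3:
  fixes k q s :: nat
  assumes "k \<ge> 1"
    and "CARD('k::{finite,field}) = q"
    and "\<not> CHAR('k) dvd k"
    and "\<not> CHAR('k) dvd (k + 1)"
    and "s = card {a::'k. a ^ (k + 1) = a}"
  shows "(\<forall>(n::nat) (m::nat) (x :: nat \<Rightarrow> 'a) (y :: nat \<Rightarrow> 'a).
            inj_on x {0..n} \<and> inj_on y {1..m} \<and> x ` {0..n} \<inter> y ` {1..m} = {} \<longrightarrow>
            num_potent (incidence_algebra TYPE('k) (fork_set n m x y) (fork_rel n m x y)) (k + 1)
            = num_potent (UT TYPE('k) (n + 1)) (k + 1) * potent_factor q s m)
       \<and> (\<forall>(X :: 'b set) (R :: 'b rel) (x0 :: 'b) (r::nat) (C :: nat \<Rightarrow> 'b set) (m :: nat \<Rightarrow> nat).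
            finite X \<and> partial_order_on X R \<and>
            r \<ge> 1 \<and> X = (\<Union>i\<in>{1..r}. C i) \<and>
            x0 \<in> X \<and> (\<forall>z\<in>X. (z, x0) \<in> R \<longrightarrow> z = x0) \<and>
            (\<forall>i\<in>{1..r}. total_on (C i) R \<and> card (C i) = m i + 1 \<and>
                        x0 \<in> C i \<and> (\<forall>z\<in>C i. (x0, z) \<in> R)) \<and>
            (\<forall>i\<in>{1..r}. \<forall>j\<in>{1..r}. i \<noteq> j \<longrightarrow>
                 C i \<inter> C j = {x0} \<and>
                 (\<forall>u\<in>C i - {x0}. \<forall>v\<in>C j - {x0}. (u, v) \<notin> R \<and> (v, u) \<notin> R)) \<longrightarrow>
            num_potent (incidence_algebra TYPE('k) X R) (k + 1)
            = num_potent (incidence_algebra TYPE('k) (C 1) (R \<inter> C 1 \<times> C 1)) (k + 1)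
              * (\<Prod>t=2..r. potent_factor q s (m t)))"
proof -
  have K: "finite (UNIV :: 'k set)" by simp
  have k0: "of_nat k \<noteq> (0 :: 'k)" using assms(3) by (simp add: of_nat_eq_0_iff_char_dvd)
  note spider = finite_poset.num_potent_spider[OF _ K assms(1) k0, where ty = "TYPE('k)",
      unfolded Suc_eq_plus1, folded assms(5), unfolded assms(2)]
  show ?thesis
  proof (intro conjI allI impI)
    fix n m :: nat and x y :: "nat \<Rightarrow> 'a"
    assume *: "inj_on x {0..n} \<and> inj_on y {1..m} \<and> x ` {0..n} \<inter> y ` {1..m} = {}"
    have x: "x i = x j \<longleftrightarrow> i = j" if "i \<le> n" "j \<le> n" for i j
      using * that by (auto dest: inj_onD)
    have y: "y i = y j \<longleftrightarrow> i = j" if "1 \<le> i" "i \<le> m" "1 \<le> j" "j \<le> m" for i j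
      using * that by (auto dest: inj_onD)
    have xy: "x i \<noteq> y j" "y j \<noteq> x i" if "i \<le> n" "1 \<le> j" "j \<le> m" for i j
      using * that by force+
    note set_iff = fork_set_iff[of _ n m x y]
    note rel = fork_rel_iff[of _ _ n m x y]
    \<comment> \<open>As the points are pairwise distinct, membership in the relation can be read
      off from the indices, and the order axioms become statements about natural numbers.\<close>
    have xx: "(x i, x j) \<in> fork_rel n m x y \<longleftrightarrow> i \<le> j" if "i \<le> n" "j \<le> n" for i j
    proof
      assume "(x i, x j) \<in> fork_rel n m x y"
      then show "i \<le> j" unfolding rel using that x xy
        by (elim disjE exE conjE) auto
    next
      assume "i \<le> j"
      then show "(x i, x j) \<in> fork_rel n m x y" unfolding rel using that by blast
    qed
    have xy': "(x i, y j) \<in> fork_rel n m x y \<longleftrightarrow> i = 0" if "i \<le> n" "1 \<le> j" "j \<le> m" for i j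
    proof
      assume "(x i, y j) \<in> fork_rel n m x y"
      then show "i = 0" unfolding rel using that x xy
        by (elim disjE exE conjE) auto
    next
      assume "i = 0"
      then show "(x i, y j) \<in> fork_rel n m x y" unfolding rel using that by blast
    qed
    have yx: "(y j, x i) \<notin> fork_rel n m x y" if "i \<le> n" "1 \<le> j" "j \<le> m" for i j
      unfolding rel using that xy by (intro notI, elim disjE exE conjE) auto
    have yy: "(y i, y j) \<in> fork_rel n m x y \<longleftrightarrow> i \<le> j"
      if "1 \<le> i" "i \<le> m" "1 \<le> j" "j \<le> m" for i j
    proof
      assume "(y i, y j) \<in> fork_rel n m x y"
      then show "i \<le> j" unfolding rel using that y xy
        by (elim disjE exE conjE) auto
    next
      assume "i \<le> j"
      then show "(y i, y j) \<in> fork_rel n m x y" unfolding rel using that by blast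
    qed
    note mem = xx xy' yx yy
    have sub: "fork_rel n m x y \<subseteq> fork_set n m x y \<times> fork_set n m x y"
    proof clarify
      fix u v assume "(u, v) \<in> fork_rel n m x y"
      then show "u \<in> fork_set n m x y \<and> v \<in> fork_set n m x y"
        unfolding rel by (elim disjE exE conjE) (auto simp: fork_set_def)
    qed
    have po: "partial_order_on (fork_set n m x y) (fork_rel n m x y)"
      unfolding partial_order_on_def preorder_on_def
    proof (intro conjI)
      show "refl_on (fork_set n m x y) (fork_rel n m x y)"
        by (auto simp: refl_on_def set_iff mem)
      show "trans (fork_rel n m x y)"
      proof (rule transI)
        fix u v w assume uvw: "(u, v) \<in> fork_rel n m x y" "(v, w) \<in> fork_rel n m x y"
        then have "u \<in> fork_set n m x y" "v \<in> fork_set n m x y" "w \<in> fork_set n m x y"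
          using sub by auto
        then show "(u, w) \<in> fork_rel n m x y"
          unfolding set_iff using uvw by (elim disjE exE conjE) (simp_all add: mem)
      qed
      show "antisym (fork_rel n m x y)"
      proof (rule antisymI)
        fix u v assume uv: "(u, v) \<in> fork_rel n m x y" "(v, u) \<in> fork_rel n m x y"
        then have "u \<in> fork_set n m x y" "v \<in> fork_set n m x y"
          using sub by auto
        then show "u = v"
          unfolding set_iff using uv by (elim disjE exE conjE) (simp_all add: mem)
      qed
    qed (rule sub)
    \<comment> \<open>The legs omit the shared point: the first chain contributes
      \<open>x 1, ..., x n\<close> and hence has \<open>n\<close> elements.\<close>
    define Y where "Y i = (if i = (0::nat) then x ` {1..n} else y ` {1..m})" for i
    have "{0..n} = insert 0 {1..n}" by auto
    then have set: "fork_set n m x y = insert (x 0) (\<Union>i\<in>{0,1}. Y i)"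
      by (auto simp: fork_set_def Y_def)
    have cardY: "card (Y 0) = n" "card (Y 1) = m"
      using * by (auto simp: Y_def card_image inj_on_subset)
    have "num_potent (incidence_algebra TYPE('k) (fork_set n m x y) (fork_rel n m x y)) (k + 1)
      = s * (\<Prod>i\<in>{0,1}. potent_factor q s (card (Y i)))"
    proof (rule spider[where ?x0.0 = "x 0"])
      show "finite_poset (fork_set n m x y) (fork_rel n m x y)"
        using po by unfold_locales (auto simp: fork_set_def)
      show "fork_set n m x y = insert (x 0) (\<Union>i\<in>{0,1}. Y i)" by (rule set)
      show "x 0 \<notin> Y i" for i using x xy by (auto simp: Y_def)
      show "(x 0, z) \<in> fork_rel n m x y" if "z \<in> fork_set n m x y" for z
        using that unfolding set_iff by (elim disjE exE conjE) (simp_all add: mem)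
      show "total_on (Y i) (fork_rel n m x y)" for i
        unfolding total_on_def Y_def by (auto simp: mem)
      show "Y i \<inter> Y j = {}" if "i \<in> {0,1}" "j \<in> {0,1}" "i \<noteq> j" for i j
        using that xy by (auto simp: Y_def)
      show "(u, v) \<notin> fork_rel n m x y" if "i \<in> {0,1}" "j \<in> {0,1}" "i \<noteq> j" "u \<in> Y i" "v \<in> Y j" for i j u v
        using that by (auto simp: Y_def mem)
    qed simp
    also have "\<dots> = s * potent_factor q s n * potent_factor q s m"
      using cardY by simp
    \<comment> \<open>Matrices of size \<open>n + 1\<close> belong to the chain
      \<open>0 < ... < n\<close>, a single leg \<open>{1..n}\<close> above the least element
      0.\<close>
    also have "s * potent_factor q s n = num_potent (UT TYPE('k) (n + 1)) (k + 1)"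
    proof -
      have "num_potent (incidence_algebra TYPE('k) {..<n + 1} {(i, j). i \<le> j \<and> j < n + 1}) (k + 1)
        = s * (\<Prod>i\<in>{0::nat}. potent_factor q s (card {1..n}))"
      proof (rule spider[where ?x0.0 = 0])
        show "finite_poset {..<n + 1} {(i, j). i \<le> j \<and> j < n + 1}"
          by unfold_locales (auto simp: partial_order_on_def preorder_on_def refl_on_def trans_def antisym_def)
      qed (auto simp: total_on_def)
      then show ?thesis by (simp add: num_potent_UT)
    qed
    finally show "num_potent (incidence_algebra TYPE('k) (fork_set n m x y) (fork_rel n m x y)) (k + 1)
      = num_potent (UT TYPE('k) (n + 1)) (k + 1) * potent_factor q s m" .
  next
    fix X :: "'b set" and R :: "'b rel" and x0 :: 'b and r :: nat and C :: "nat \<Rightarrow> 'b set"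
      and m :: "nat \<Rightarrow> nat"
    assume *: "finite X \<and> partial_order_on X R \<and>
            r \<ge> 1 \<and> X = (\<Union>i\<in>{1..r}. C i) \<and>
            x0 \<in> X \<and> (\<forall>z\<in>X. (z, x0) \<in> R \<longrightarrow> z = x0) \<and>
            (\<forall>i\<in>{1..r}. total_on (C i) R \<and> card (C i) = m i + 1 \<and>
                        x0 \<in> C i \<and> (\<forall>z\<in>C i. (x0, z) \<in> R)) \<and>
            (\<forall>i\<in>{1..r}. \<forall>j\<in>{1..r}. i \<noteq> j \<longrightarrow>
                 C i \<inter> C j = {x0} \<and>
                 (\<forall>u\<in>C i - {x0}. \<forall>v\<in>C j - {x0}. (u, v) \<notin> R \<and> (v, u) \<notin> R))"
    then have fin: "finite X" and po: "partial_order_on X R" and r: "1 \<in> {1..r}"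
      and X: "X = (\<Union>i\<in>{1..r}. C i)"
      and tot: "\<And>i. i \<in> {1..r} \<Longrightarrow> total_on (C i) R"
      and card: "\<And>i. i \<in> {1..r} \<Longrightarrow> card (C i) = m i + 1"
      and x0: "\<And>i. i \<in> {1..r} \<Longrightarrow> x0 \<in> C i"
      and least: "\<And>i z. i \<in> {1..r} \<Longrightarrow> z \<in> C i \<Longrightarrow> (x0, z) \<in> R"
      and disj: "\<And>i j. i \<in> {1..r} \<Longrightarrow> j \<in> {1..r} \<Longrightarrow> i \<noteq> j \<Longrightarrow> C i \<inter> C j = {x0}"
      and inc: "\<And>i j u v. i \<in> {1..r} \<Longrightarrow> j \<in> {1..r} \<Longrightarrow> i \<noteq> j \<Longrightarrow> u \<in> C i - {x0} \<Longrightarrow>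
        v \<in> C j - {x0} \<Longrightarrow> (u, v) \<notin> R"
      by auto
    have cardY: "card (C i - {x0}) = m i" if "i \<in> {1..r}" for i
      using card[OF that] x0[OF that] by simp
    \<comment> \<open>The legs are the chains with \<open>x0\<close> removed, so the leg of
      \<open>C i\<close> has \<open>m i\<close> elements.\<close>
    have "num_potent (incidence_algebra TYPE('k) X R) (k + 1)
      = s * (\<Prod>i\<in>{1..r}. potent_factor q s (card (C i - {x0})))"
    proof (rule spider[where ?x0.0 = x0])
      show "finite_poset X R" using fin po by unfold_locales
      show "X = insert x0 (\<Union>i\<in>{1..r}. C i - {x0})" using X x0[OF r] r by auto
      show "(x0, z) \<in> R" if "z \<in> X" for z using that least by (auto simp: X)
      show "total_on (C i - {x0}) R" if "i \<in> {1..r}" for i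
        using tot[OF that] by (rule total_on_subset) auto
      show "(C i - {x0}) \<inter> (C j - {x0}) = {}" if "i \<in> {1..r}" "j \<in> {1..r}" "i \<noteq> j" for i j
        using disj[OF that] by auto
    qed (use inc in auto)
    also have "\<dots> = s * (\<Prod>i\<in>{1..r}. potent_factor q s (m i))"
      by (simp add: cardY)
    also have "{1..r} = insert 1 {2..r}" using r by auto
    also have "s * (\<Prod>i\<in>insert 1 {2..r}. potent_factor q s (m i))
      = s * potent_factor q s (m 1) * (\<Prod>t=2..r. potent_factor q s (m t))" by simp
    \<comment> \<open>The scalar count times the first factor is the one-leg formula for the chain
      \<open>C 1\<close> with the induced order.\<close>
    also have "s * potent_factor q s (m 1)
      = num_potent (incidence_algebra TYPE('k) (C 1) (R \<inter> C 1 \<times> C 1)) (k + 1)"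
    proof -
      have sub: "C 1 \<subseteq> X" using r by (auto simp: X)
      have "num_potent (incidence_algebra TYPE('k) (C 1) (R \<inter> C 1 \<times> C 1)) (k + 1)
        = s * (\<Prod>i\<in>{1::nat}. potent_factor q s (card (C i - {x0})))"
      proof (rule spider[where ?x0.0 = x0])
        show "finite_poset (C 1) (R \<inter> C 1 \<times> C 1)"
        proof
          show "finite (C 1)" using sub fin by (rule finite_subset)
          show "partial_order_on (C 1) (R \<inter> C 1 \<times> C 1)"
            using po sub unfolding partial_order_on_def preorder_on_def
            by (auto simp: refl_on_def trans_def antisym_def)
        qed
      qed (use x0[OF r] least[OF r] tot[OF r] in \<open>auto simp: total_on_def\<close>)
      then show ?thesis using cardY[OF r] by simp
    qed
    finally show "num_potent (incidence_algebra TYPE('k) X R) (k + 1)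
      = num_potent (incidence_algebra TYPE('k) (C 1) (R \<inter> C 1 \<times> C 1)) (k + 1)
        * (\<Prod>t=2..r. potent_factor q s (m t))" .
  qed
qed

end
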